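(* For an integer $N\ge1$ let $\mathcal M_N=[(z-w)^N]$. Then $$\operatorname{spec}(C_{\mathcal M_N})\setminus\{0\}=\left\{1,\ \pm\frac{N}{N+1},\ \pm\frac{N}{N+2},\ldots\right\},$$ $$\|X_{\mathcal M_N}\|_{HS}^2=N^2\sum_{j=N+1}^{\infty}\frac1{j^2},$$ $$\|C_{\mathcal M_N}\|_{HS}^2=1+2N^2\sum_{j=N+1}^{\infty}\frac1{j^2}=2N+\frac1{3N}-\frac1{15N^3}+O(N^{-5})\qquad(N\to\infty).$$ In particular, $$\sup\{\|C_{[p]}\|_{HS}:0\ne p\in\mathbb C[z,w]\text{ homogeneous}\}=\infty .$$
   Context: $H^2(\mathbb D^2)$ is the Hardy space of the bidisc, and $[p]$ is the closure of $p\,\mathbb C[z,w]$ in $H^2(\mathbb D^2)$. For $\mathcal M=[p]$ let $R_z,R_w$ be the restrictions to $\mathcal M$ of multiplication by $z,w$, and put $X_{\mathcal M}=R_z^*R_w-R_wR_z^*$ and $C_{\mathcal M}=I-R_zR_z^*-R_wR_w^*+R_zR_wR_z^*R_w^*$. $\|\cdot\|_{HS}$ is the Hilbert--Schmidt norm. *)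

theory Defs
  imports
    "HOL-Analysis.Analysis"
    "HOL-Computational_Algebra.Polynomial"
    "HOL-Library.Landau_Symbols"
begin

section \<open>The Hardy space of the bidisc\<close>

definition bidisc :: "(complex \<times> complex) set" where
  "bidisc = ball 0 1 \<times> ball 0 1"

definition has_taylor :: "(complex \<times> complex \<Rightarrow> complex) \<Rightarrow> (nat \<times> nat \<Rightarrow> complex) \<Rightarrow> bool" where
  "has_taylor f a \<longleftrightarrow>
     (\<forall>(z, w) \<in> bidisc. ((\<lambda>(i, j). a (i, j) * z ^ i * w ^ j) has_sum f (z, w)) UNIV)"

text \<open>The functions on the bidisc with square-summable Taylor coefficients.  A function on the
  bidisc is represented by its extension by zero, so that equality is equality on the bidisc.\<close>

definition hardy2_set :: "(complex \<times> complex \<Rightarrow> complex) set" where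
  "hardy2_set = {f. (\<exists>a. has_taylor f a \<and> (\<lambda>k. (cmod (a k))\<^sup>2) summable_on UNIV) \<and>
                    (\<forall>x. x \<notin> bidisc \<longrightarrow> f x = 0)}"

lemma has_taylor_0: "has_taylor (\<lambda>_. 0) (\<lambda>_. 0)"
  by (auto simp: has_taylor_def case_prod_unfold)

lemma has_taylor_add:
  assumes "has_taylor f a" "has_taylor g b"
  shows "has_taylor (\<lambda>x. f x + g x) (\<lambda>k. a k + b k)"
  unfolding has_taylor_def
proof clarify
  fix z w assume "(z, w) \<in> bidisc"
  then have "((\<lambda>k. (case k of (i, j) \<Rightarrow> a (i, j) * z ^ i * w ^ j) +
      (case k of (i, j) \<Rightarrow> b (i, j) * z ^ i * w ^ j)) has_sum (f (z, w) + g (z, w))) UNIV"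
    using assms unfolding has_taylor_def by (intro has_sum_add) blast+
  then show "((\<lambda>(i, j). (a (i, j) + b (i, j)) * z ^ i * w ^ j) has_sum (f (z, w) + g (z, w))) UNIV"
    by (simp add: case_prod_unfold algebra_simps)
qed

lemma has_taylor_cmult:
  assumes "has_taylor f a"
  shows "has_taylor (\<lambda>x. c * f x) (\<lambda>k. c * a k)"
  unfolding has_taylor_def
proof clarify
  fix z w assume "(z, w) \<in> bidisc"
  then have "((\<lambda>k. c * (case k of (i, j) \<Rightarrow> a (i, j) * z ^ i * w ^ j)) has_sum (c * f (z, w))) UNIV"
    using assms unfolding has_taylor_def by (intro has_sum_cmult_right) blast
  then show "((\<lambda>(i, j). (c * a (i, j)) * z ^ i * w ^ j) has_sum (c * f (z, w))) UNIV"
    by (simp add: case_prod_unfold algebra_simps)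
qed

lemma powser_eq_0D:
  fixes c :: "nat \<Rightarrow> complex"
  assumes "\<And>w. norm w < 1 \<Longrightarrow> (\<lambda>j. c j * w ^ j) sums 0"
  shows "c n = 0"
proof (induction n rule: less_induct)
  case (less n)
  have s: "(\<lambda>j. c (j + n) * w ^ j) sums 0" if w: "w \<noteq> 0" "norm w < 1" for w
  proof -
    have "(\<lambda>j. c (j + n) * w ^ (j + n)) sums 0"
      using assms[OF w(2)] less by (subst sums_zero_iff_shift) auto
    then have "(\<lambda>j. c (j + n) * w ^ (j + n) * inverse (w ^ n)) sums (0 * inverse (w ^ n))"
      by (rule sums_mult2)
    then show ?thesis using w by (simp add: power_add field_simps)
  qed
  have "((\<lambda>w::complex. 0) \<longlongrightarrow> c (0 + n)) (at 0)"
    by (rule powser_limit_0_strong[of 1 "\<lambda>j. c (j + n)"]) (use s in auto)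
  then show ?case by (auto dest: LIM_const_eq)
qed

lemma has_taylor_zeroD:
  assumes "has_taylor (\<lambda>_. 0) a"
  shows "a = (\<lambda>_. 0)"
proof -
  have "a (i, j) = 0" for i j
  proof -
    have sum: "((\<lambda>(i, j). a (i, j) * z ^ i * w ^ j) has_sum 0) UNIV"
      if "norm z < 1" "norm w < 1" for z w
      using assms that by (auto simp: has_taylor_def bidisc_def)
    have inner: "(\<lambda>j. a (i, j) * w ^ j) summable_on UNIV" if "norm w < 1" for i w
    proof -
      have "(\<lambda>(i, j). a (i, j) * (1/2) ^ i * w ^ j) summable_on UNIV \<times> UNIV"
        using sum[of "1/2" w] that by (auto simp: summable_on_def)
      then have "(\<lambda>(i, j). a (i, j) * (1/2) ^ i * w ^ j) summable_on Pair i ` UNIV"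
        by (rule summable_on_subset_banach) auto
      then have "(\<lambda>j. a (i, j) * (1/2) ^ i * w ^ j) summable_on UNIV"
        by (subst (asm) summable_on_reindex) (auto simp: inj_on_def o_def)
      then have "(\<lambda>j. 2 ^ i * (a (i, j) * (1/2) ^ i * w ^ j)) summable_on UNIV"
        by (rule summable_on_cmult_right)
      then show ?thesis by (simp add: field_simps)
    qed
    have row: "(\<Sum>\<^sub>\<infinity>j. a (i, j) * w ^ j) = 0" if w: "norm w < 1" for i w
    proof (rule powser_eq_0D)
      fix z :: complex assume z: "norm z < 1"
      have "((\<lambda>i. (\<Sum>\<^sub>\<infinity>j. a (i, j) * w ^ j) * z ^ i) has_sum 0) UNIV"
      proof (rule has_sum_SigmaD)
        show "((\<lambda>(i, j). a (i, j) * z ^ i * w ^ j) has_sum 0) (UNIV \<times> UNIV)"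
          using sum[OF z w] by simp
        fix i
        have "((\<lambda>j. a (i, j) * w ^ j * z ^ i) has_sum ((\<Sum>\<^sub>\<infinity>j. a (i, j) * w ^ j) * z ^ i)) UNIV"
          by (intro has_sum_cmult_left has_sum_infsum inner w)
        then show "((\<lambda>j. case (i, j) of (i, j) \<Rightarrow> a (i, j) * z ^ i * w ^ j) has_sum
              (\<Sum>\<^sub>\<infinity>j. a (i, j) * w ^ j) * z ^ i) UNIV"
          by (simp add: mult_ac)
      qed
      then show "(\<lambda>i. (\<Sum>\<^sub>\<infinity>j. a (i, j) * w ^ j) * z ^ i) sums 0"
        by (rule has_sum_imp_sums)
    qed
    show ?thesis
    proof (rule powser_eq_0D)
      fix w :: complex assume w: "norm w < 1"
      show "(\<lambda>j. a (i, j) * w ^ j) sums 0"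
        using has_sum_imp_sums[OF has_sum_infsum[OF inner[OF w]]] row[OF w] by simp
    qed
  qed
  then show ?thesis by auto
qed

lemma has_taylor_unique:
  assumes "has_taylor f a" "has_taylor f b"
  shows "a = b"
proof -
  have "has_taylor (\<lambda>x. f x + (-1) * f x) (\<lambda>k. a k + (-1) * b k)"
    by (intro has_taylor_add has_taylor_cmult assms)
  then have "(\<lambda>k. a k + (-1) * b k) = (\<lambda>_. 0)"
    by (intro has_taylor_zeroD) simp
  then show ?thesis by (simp add: fun_eq_iff)
qed

lemma sq_summable_add:
  assumes "(\<lambda>k. (cmod (a k))\<^sup>2) summable_on A" "(\<lambda>k. (cmod (b k))\<^sup>2) summable_on A"
  shows "(\<lambda>k. (cmod (a k + b k))\<^sup>2) summable_on A"
proof (rule summable_on_comparison_test)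
  show "(\<lambda>k. 2 * (cmod (a k))\<^sup>2 + 2 * (cmod (b k))\<^sup>2) summable_on A"
    by (intro summable_on_add summable_on_cmult_right assms)
  fix k
  have "(cmod (a k + b k))\<^sup>2 \<le> (cmod (a k) + cmod (b k))\<^sup>2"
    by (intro power_mono norm_triangle_ineq) auto
  also have "\<dots> \<le> 2 * (cmod (a k))\<^sup>2 + 2 * (cmod (b k))\<^sup>2"
    using sum_squares_bound[of "cmod (a k)" "cmod (b k)"] by (simp add: power2_sum)
  finally show "(cmod (a k + b k))\<^sup>2 \<le> 2 * (cmod (a k))\<^sup>2 + 2 * (cmod (b k))\<^sup>2" .
qed auto

lemma sq_summable_cmult:
  assumes "(\<lambda>k. (cmod (a k))\<^sup>2) summable_on A"
  shows "(\<lambda>k. (cmod (c * a k))\<^sup>2) summable_on A"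
  using summable_on_cmult_right[OF assms, of "(cmod c)\<^sup>2"]
  by (simp add: norm_mult power_mult_distrib)

lemma sq_summable_mult_cnj:
  assumes "(\<lambda>k. (cmod (a k))\<^sup>2) summable_on A" "(\<lambda>k. (cmod (b k))\<^sup>2) summable_on A"
  shows "(\<lambda>k. a k * cnj (b k)) summable_on A"
proof (rule abs_summable_summable, rule summable_on_comparison_test)
  show "(\<lambda>k. (cmod (a k))\<^sup>2 + (cmod (b k))\<^sup>2) summable_on A"
    by (intro summable_on_add assms)
  fix k
  have "0 \<le> cmod (a k) * cmod (b k)" by simp
  then show "norm (a k * cnj (b k)) \<le> (cmod (a k))\<^sup>2 + (cmod (b k))\<^sup>2"
    using sum_squares_bound[of "cmod (a k)" "cmod (b k)"] unfolding norm_mult complex_mod_cnj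
    by linarith
qed auto

typedef hardy2 = hardy2_set
  morphisms h2_fun Abs_hardy2
  unfolding hardy2_set_def using has_taylor_0 by (intro exI[of _ "\<lambda>_. 0"]) auto

setup_lifting type_definition_hardy2

definition h2_coeff :: "hardy2 \<Rightarrow> nat \<times> nat \<Rightarrow> complex" where
  "h2_coeff f = (THE a. has_taylor (h2_fun f) a)"

lemma h2_coeffI: "has_taylor (h2_fun f) a \<Longrightarrow> h2_coeff f = a"
  unfolding h2_coeff_def using has_taylor_unique by blast

lemma has_taylor_h2_coeff: "has_taylor (h2_fun f) (h2_coeff f)"
  using h2_fun[of f] h2_coeffI[of f] by (auto simp: hardy2_set_def)

lemma h2_coeff_sq_summable: "(\<lambda>k. (cmod (h2_coeff f k))\<^sup>2) summable_on UNIV"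
  using h2_fun[of f] h2_coeffI[of f] by (auto simp: hardy2_set_def)

lemma h2_coeff_inject:
  assumes "h2_coeff f = h2_coeff g"
  shows "f = g"
proof -
  have "h2_fun f x = h2_fun g x" for x
  proof (cases "x \<in> bidisc")
    case True
    then show ?thesis
      using has_taylor_h2_coeff[of f] has_taylor_h2_coeff[of g] assms
      by (cases x) (auto simp: has_taylor_def intro: has_sum_unique)
  next
    case False
    have "h2_fun h x = 0" for h
      using h2_fun[of h] False unfolding hardy2_set_def mem_Collect_eq by blast
    then show ?thesis by simp
  qed
  then show ?thesis by (simp add: h2_fun_inject[symmetric] fun_eq_iff)
qed

lemma hardy2_set_add:
  assumes "f \<in> hardy2_set" "g \<in> hardy2_set"
  shows "(\<lambda>x. f x + g x) \<in> hardy2_set"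
  using assms has_taylor_add sq_summable_add unfolding hardy2_set_def by fastforce

lemma hardy2_set_cmult: "f \<in> hardy2_set \<Longrightarrow> (\<lambda>x. c * f x) \<in> hardy2_set"
  using has_taylor_cmult[of f _ c] sq_summable_cmult[of _ UNIV c]
  unfolding hardy2_set_def by fastforce

instantiation hardy2 :: ab_group_add
begin

lift_definition zero_hardy2 :: hardy2 is "\<lambda>_. 0"
  unfolding hardy2_set_def using has_taylor_0 by (auto intro: exI[of _ "\<lambda>_. 0"])

lift_definition plus_hardy2 :: "hardy2 \<Rightarrow> hardy2 \<Rightarrow> hardy2" is "\<lambda>f g x. f x + g x"
  by (rule hardy2_set_add)

lift_definition uminus_hardy2 :: "hardy2 \<Rightarrow> hardy2" is "\<lambda>f x. - f x"
  using hardy2_set_cmult[of _ "-1"] by simp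

lift_definition minus_hardy2 :: "hardy2 \<Rightarrow> hardy2 \<Rightarrow> hardy2" is "\<lambda>f g x. f x - g x"
  using hardy2_set_add hardy2_set_cmult[of _ "-1"] by fastforce

instance
  by standard (transfer; simp add: algebra_simps; fail)+

end

lift_definition scaleC :: "complex \<Rightarrow> hardy2 \<Rightarrow> hardy2" (infixr \<open>*\<^sub>C\<close> 75) is "\<lambda>c f x. c * f x"
  by (rule hardy2_set_cmult)

global_interpretation hardy2: vector_space scaleC
  by standard (transfer; simp add: algebra_simps; fail)+

lemma h2_coeff_0 [simp]: "h2_coeff 0 k = 0"
  by (simp add: h2_coeffI[of 0 "\<lambda>_. 0"] zero_hardy2.rep_eq has_taylor_0)

lemma h2_coeff_add [simp]: "h2_coeff (f + g) k = h2_coeff f k + h2_coeff g k"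
  by (subst h2_coeffI[of "f + g"], unfold plus_hardy2.rep_eq,
      rule has_taylor_add[OF has_taylor_h2_coeff has_taylor_h2_coeff]) simp

lemma h2_coeff_scaleC [simp]: "h2_coeff (c *\<^sub>C f) k = c * h2_coeff f k"
  by (subst h2_coeffI[of "c *\<^sub>C f"], unfold scaleC.rep_eq,
      rule has_taylor_cmult[OF has_taylor_h2_coeff]) simp

definition cinner :: "hardy2 \<Rightarrow> hardy2 \<Rightarrow> complex" where
  "cinner f g = (\<Sum>\<^sub>\<infinity>k. h2_coeff f k * cnj (h2_coeff g k))"

lemma cinner_summable: "(\<lambda>k. h2_coeff f k * cnj (h2_coeff g k)) summable_on UNIV"
  by (intro sq_summable_mult_cnj h2_coeff_sq_summable)

lemma cinner_add_left: "cinner (f + g) h = cinner f h + cinner g h"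
  by (simp add: cinner_def distrib_right infsum_add cinner_summable)

lemma cinner_scaleC_left: "cinner (c *\<^sub>C f) g = c * cinner f g"
  by (simp add: cinner_def mult.assoc infsum_cmult_right')

lemma cinner_commute: "cinner f g = cnj (cinner g f)"
  by (simp add: cinner_def infsum_cnj[symmetric] mult.commute del: infsum_cnj)

lemma Re_cinner_self: "Re (cinner f f) = (\<Sum>\<^sub>\<infinity>k. (cmod (h2_coeff f k))\<^sup>2)"
proof -
  have "Re (cinner f f) = (\<Sum>\<^sub>\<infinity>k. Re (h2_coeff f k * cnj (h2_coeff f k)))"
    unfolding cinner_def by (rule infsum_Re[OF cinner_summable, symmetric])
  also have "\<dots> = (\<Sum>\<^sub>\<infinity>k. (cmod (h2_coeff f k))\<^sup>2)"
    by (intro infsum_cong) (simp add: cmod_power2, simp add: power2_eq_square)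
  finally show ?thesis .
qed

text \<open>The underlying real Hilbert space structure: its norm \<open>\<surd>Re \<langle>f, f\<rangle>\<close> and its topology are
  those of the complex inner product.\<close>

instantiation hardy2 :: real_inner
begin

definition scaleR_hardy2 :: "real \<Rightarrow> hardy2 \<Rightarrow> hardy2" where
  "scaleR_hardy2 r f = of_real r *\<^sub>C f"

definition inner_hardy2 :: "hardy2 \<Rightarrow> hardy2 \<Rightarrow> real" where
  "inner_hardy2 f g = Re (cinner f g)"

definition norm_hardy2 :: "hardy2 \<Rightarrow> real" where
  "norm_hardy2 f = sqrt (inner f f)"

definition dist_hardy2 :: "hardy2 \<Rightarrow> hardy2 \<Rightarrow> real" where
  "dist_hardy2 f g = norm (f - g)"

definition sgn_hardy2 :: "hardy2 \<Rightarrow> hardy2" where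
  "sgn_hardy2 f = inverse (norm f) *\<^sub>R f"

definition uniformity_hardy2 :: "(hardy2 \<times> hardy2) filter" where
  "uniformity_hardy2 = (INF e\<in>{0<..}. principal {(f, g). dist f g < e})"

definition open_hardy2 :: "hardy2 set \<Rightarrow> bool" where
  "open_hardy2 U \<longleftrightarrow> (\<forall>f\<in>U. eventually (\<lambda>(f', g). f' = f \<longrightarrow> g \<in> U) uniformity)"

instance
proof
  fix f g h :: hardy2 and r s :: real
  show "r *\<^sub>R (f + g) = r *\<^sub>R f + r *\<^sub>R g"
    by (simp add: scaleR_hardy2_def hardy2.scale_right_distrib)
  show "(r + s) *\<^sub>R f = r *\<^sub>R f + s *\<^sub>R f"
    by (simp add: scaleR_hardy2_def hardy2.scale_left_distrib)
  show "r *\<^sub>R s *\<^sub>R f = (r * s) *\<^sub>R f" "1 *\<^sub>R f = f"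
    by (simp_all add: scaleR_hardy2_def)
  show "inner f g = inner g f"
    unfolding inner_hardy2_def by (subst cinner_commute) simp
  show "inner (f + g) h = inner f h + inner g h"
    by (simp add: inner_hardy2_def cinner_add_left)
  show "inner (r *\<^sub>R f) g = r * inner f g"
    by (simp add: inner_hardy2_def scaleR_hardy2_def cinner_scaleC_left)
  show "0 \<le> inner f f"
    by (auto simp: inner_hardy2_def Re_cinner_self intro: infsum_nonneg)
  show "inner f f = 0 \<longleftrightarrow> f = 0"
  proof
    assume "inner f f = 0"
    then have "(cmod (h2_coeff f k))\<^sup>2 = 0" for k
      by (intro nonneg_infsum_le_0D[OF _ h2_coeff_sq_summable])
        (auto simp: inner_hardy2_def Re_cinner_self)
    then show "f = 0"
      by (intro h2_coeff_inject ext) simp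
  next
    assume "f = 0"
    then show "inner f f = 0" by (simp add: inner_hardy2_def cinner_def)
  qed
qed (simp_all add: dist_hardy2_def norm_hardy2_def sgn_hardy2_def uniformity_hardy2_def
      open_hardy2_def)

end


section \<open>Polynomials and the submodules they generate\<close>

text \<open>The ring of polynomials in \<open>z, w\<close> is rendered as the type \<^typ>\<open>complex poly poly\<close>: the outer
  variable is \<open>w\<close> and the coefficients are polynomials in \<open>z\<close>.\<close>

definition var_z :: "complex poly poly" where
  "var_z = [:[:0, 1:]:]"

definition var_w :: "complex poly poly" where
  "var_w = [:0, 1:]"

definition eval2 :: "complex poly poly \<Rightarrow> complex \<Rightarrow> complex \<Rightarrow> complex" where
  "eval2 p z w = poly (poly p [:w:]) z"

definition homogeneous2 :: "complex poly poly \<Rightarrow> bool" where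
  "homogeneous2 p \<longleftrightarrow> (\<exists>d. \<forall>i j. coeff (coeff p j) i \<noteq> 0 \<longrightarrow> i + j = d)"

lemma eval2_altdef:
  "eval2 p z w = (\<Sum>j\<le>degree p. \<Sum>i\<le>degree (coeff p j). coeff (coeff p j) i * z ^ i * w ^ j)"
proof -
  have "eval2 p z w = (\<Sum>j\<le>degree p. poly (coeff p j) z * w ^ j)"
    unfolding eval2_def poly_altdef[of p] by (simp add: poly_sum)
  then show ?thesis by (simp add: poly_altdef[of _ z] sum_distrib_right)
qed

lift_definition h2_poly :: "complex poly poly \<Rightarrow> hardy2" is
  "\<lambda>p (z, w). if (z, w) \<in> bidisc then eval2 p z w else 0"
proof -
  fix p :: "complex poly poly"
  define a where "a = (\<lambda>(i, j). coeff (coeff p j) i)"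
  define S where "S = (\<lambda>(j, i). (i, j)) ` (SIGMA j:{..degree p}. {..degree (coeff p j)})"
  have fin: "finite S" by (auto simp: S_def)
  have nz: "a k = 0" if "k \<notin> S" for k
  proof (rule ccontr)
    assume k: "a k \<noteq> 0"
    obtain i j where [simp]: "k = (i, j)" by (cases k)
    from k have "coeff (coeff p j) i \<noteq> 0" by (simp add: a_def)
    then have "i \<le> degree (coeff p j)" "j \<le> degree p"
      by (auto intro!: le_degree)
    then show False using that by (force simp: S_def)
  qed
  have "has_taylor (\<lambda>(z, w). if (z, w) \<in> bidisc then eval2 p z w else 0) a"
    unfolding has_taylor_def
  proof clarify
    fix z w assume zw: "(z, w) \<in> bidisc"
    have "((\<lambda>(i, j). a (i, j) * z ^ i * w ^ j) has_sum eval2 p z w) UNIV"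
    proof (rule has_sum_finite_neutralI[OF fin])
      show "eval2 p z w = (\<Sum>(i, j)\<in>S. a (i, j) * z ^ i * w ^ j)"
        unfolding S_def eval2_altdef
        by (subst sum.reindex) (auto simp: inj_on_def a_def sum.Sigma case_prod_unfold)
    qed (use nz in auto)
    then show "((\<lambda>(i, j). a (i, j) * z ^ i * w ^ j) has_sum
        (if (z, w) \<in> bidisc then eval2 p z w else 0)) UNIV"
      using zw by simp
  qed
  moreover have "(\<lambda>k. (cmod (a k))\<^sup>2) summable_on UNIV"
    by (rule finite_nonzero_values_imp_summable_on)
      (rule finite_subset[OF _ fin], use nz in auto)
  ultimately show "(\<lambda>(z, w). if (z, w) \<in> bidisc then eval2 p z w else 0) \<in> hardy2_set"
    unfolding hardy2_set_def by auto
qed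

definition poly_submodule :: "complex poly poly \<Rightarrow> hardy2 set" where
  "poly_submodule p = closure (range (\<lambda>q. h2_poly (p * q)))"

definition diag_submodule :: "nat \<Rightarrow> hardy2 set" where
  "diag_submodule N = poly_submodule ((var_z - var_w) ^ N)"

lift_definition mult_z :: "hardy2 \<Rightarrow> hardy2" is "\<lambda>f (z, w). z * f (z, w)"
proof -
  fix f :: "complex \<times> complex \<Rightarrow> complex" assume "f \<in> hardy2_set"
  then obtain a where a: "has_taylor f a" "(\<lambda>k. (cmod (a k))\<^sup>2) summable_on UNIV"
    and f0: "\<forall>x. x \<notin> bidisc \<longrightarrow> f x = 0"
    by (auto simp: hardy2_set_def)
  define b where "b = (\<lambda>(i, j). if i = 0 then 0 else a (i - 1, j))"
  define s :: "nat \<times> nat \<Rightarrow> nat \<times> nat" where "s = (\<lambda>(i, j). (Suc i, j))"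
  have inj: "inj s" by (auto simp: s_def inj_def)
  have b0: "b k = 0" if "k \<notin> range s" for k
  proof -
    obtain i j where [simp]: "k = (i, j)" by (cases k)
    have "i = 0" using that by (cases i) (auto simp: s_def image_def)
    then show ?thesis by (simp add: b_def)
  qed
  have bs: "b (s k) = a k" for k by (auto simp: b_def s_def split: prod.splits)
  have "has_taylor (\<lambda>(z, w). z * f (z, w)) b"
    unfolding has_taylor_def
  proof clarify
    fix z w assume "(z, w) \<in> bidisc"
    then have "((\<lambda>(i, j). a (i, j) * z ^ i * w ^ j) has_sum f (z, w)) UNIV"
      using a by (auto simp: has_taylor_def)
    then have "((\<lambda>k. z * (case k of (i, j) \<Rightarrow> a (i, j) * z ^ i * w ^ j)) has_sum z * f (z, w)) UNIV"
      by (rule has_sum_cmult_right)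
    also have "(\<lambda>k. z * (case k of (i, j) \<Rightarrow> a (i, j) * z ^ i * w ^ j)) =
        (\<lambda>(i, j). b (i, j) * z ^ i * w ^ j) \<circ> s"
      by (auto simp: fun_eq_iff b_def s_def)
    finally have "((\<lambda>(i, j). b (i, j) * z ^ i * w ^ j) has_sum z * f (z, w)) (range s)"
      by (subst has_sum_reindex[OF inj])
    then show "((\<lambda>(i, j). b (i, j) * z ^ i * w ^ j) has_sum z * f (z, w)) UNIV"
      by (subst has_sum_cong_neutral[of "range s" UNIV]) (use b0 in auto)
  qed
  moreover have "(\<lambda>k. (cmod (b k))\<^sup>2) summable_on range s"
    by (subst summable_on_reindex[OF inj]) (use a in \<open>simp add: o_def bs\<close>)
  then have "(\<lambda>k. (cmod (b k))\<^sup>2) summable_on UNIV"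
    by (subst summable_on_cong_neutral[of "range s" UNIV]) (use b0 in auto)
  ultimately show "(\<lambda>(z, w). z * f (z, w)) \<in> hardy2_set"
    using f0 unfolding hardy2_set_def by auto
qed

lift_definition mult_w :: "hardy2 \<Rightarrow> hardy2" is "\<lambda>f (z, w). w * f (z, w)"
proof -
  fix f :: "complex \<times> complex \<Rightarrow> complex" assume "f \<in> hardy2_set"
  then obtain a where a: "has_taylor f a" "(\<lambda>k. (cmod (a k))\<^sup>2) summable_on UNIV"
    and f0: "\<forall>x. x \<notin> bidisc \<longrightarrow> f x = 0"
    by (auto simp: hardy2_set_def)
  define b where "b = (\<lambda>(i, j). if j = 0 then 0 else a (i, j - 1))"
  define s :: "nat \<times> nat \<Rightarrow> nat \<times> nat" where "s = (\<lambda>(i, j). (i, Suc j))"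
  have inj: "inj s" by (auto simp: s_def inj_def)
  have b0: "b k = 0" if "k \<notin> range s" for k
  proof -
    obtain i j where [simp]: "k = (i, j)" by (cases k)
    have "j = 0" using that by (cases j) (auto simp: s_def image_def)
    then show ?thesis by (simp add: b_def)
  qed
  have bs: "b (s k) = a k" for k by (auto simp: b_def s_def split: prod.splits)
  have "has_taylor (\<lambda>(z, w). w * f (z, w)) b"
    unfolding has_taylor_def
  proof clarify
    fix z w assume "(z, w) \<in> bidisc"
    then have "((\<lambda>(i, j). a (i, j) * z ^ i * w ^ j) has_sum f (z, w)) UNIV"
      using a by (auto simp: has_taylor_def)
    then have "((\<lambda>k. w * (case k of (i, j) \<Rightarrow> a (i, j) * z ^ i * w ^ j)) has_sum w * f (z, w)) UNIV"
      by (rule has_sum_cmult_right)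
    also have "(\<lambda>k. w * (case k of (i, j) \<Rightarrow> a (i, j) * z ^ i * w ^ j)) =
        (\<lambda>(i, j). b (i, j) * z ^ i * w ^ j) \<circ> s"
      by (auto simp: fun_eq_iff b_def s_def)
    finally have "((\<lambda>(i, j). b (i, j) * z ^ i * w ^ j) has_sum w * f (z, w)) (range s)"
      by (subst has_sum_reindex[OF inj])
    then show "((\<lambda>(i, j). b (i, j) * z ^ i * w ^ j) has_sum w * f (z, w)) UNIV"
      by (subst has_sum_cong_neutral[of "range s" UNIV]) (use b0 in auto)
  qed
  moreover have "(\<lambda>k. (cmod (b k))\<^sup>2) summable_on range s"
    by (subst summable_on_reindex[OF inj]) (use a in \<open>simp add: o_def bs\<close>)
  then have "(\<lambda>k. (cmod (b k))\<^sup>2) summable_on UNIV"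
    by (subst summable_on_cong_neutral[of "range s" UNIV]) (use b0 in auto)
  ultimately show "(\<lambda>(z, w). w * f (z, w)) \<in> hardy2_set"
    using f0 unfolding hardy2_set_def by auto
qed


section \<open>Operators on a closed subspace\<close>

text \<open>An operator on a closed complex subspace \<open>M\<close> is represented by a function on the whole type
  of which only the values on \<open>M\<close> matter.\<close>

definition bounded_op_on :: "hardy2 set \<Rightarrow> (hardy2 \<Rightarrow> hardy2) \<Rightarrow> bool" where
  "bounded_op_on M T \<longleftrightarrow>
     (\<forall>f\<in>M. T f \<in> M) \<and>
     (\<forall>f\<in>M. \<forall>g\<in>M. T (f + g) = T f + T g) \<and>
     (\<forall>c. \<forall>f\<in>M. T (c *\<^sub>C f) = c *\<^sub>C T f) \<and>
     (\<exists>K. \<forall>f\<in>M. norm (T f) \<le> K * norm f)"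

definition adjoint_on :: "hardy2 set \<Rightarrow> (hardy2 \<Rightarrow> hardy2) \<Rightarrow> hardy2 \<Rightarrow> hardy2" where
  "adjoint_on M T g = (THE h. h \<in> M \<and> (\<forall>f\<in>M. cinner (T f) g = cinner f h))"

definition spectrum_on :: "hardy2 set \<Rightarrow> (hardy2 \<Rightarrow> hardy2) \<Rightarrow> complex set" where
  "spectrum_on M T = {c. \<not> (\<exists>S. bounded_op_on M S \<and>
     (\<forall>f\<in>M. S (T f - c *\<^sub>C f) = f \<and> T (S f) - c *\<^sub>C S f = f))}"

definition orthonormal_basis_of :: "hardy2 set \<Rightarrow> hardy2 set \<Rightarrow> bool" where
  "orthonormal_basis_of M B \<longleftrightarrow>
     (\<forall>e\<in>B. \<forall>e'\<in>B. cinner e e' = (if e = e' then 1 else 0)) \<and>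
     closure (hardy2.span B) = M"

text \<open>The sum does not depend on the orthonormal basis of \<open>M\<close>; the value is \<open>\<infinity>\<close> if \<open>T\<close> is not a
  Hilbert--Schmidt operator.\<close>

definition hs_norm :: "hardy2 set \<Rightarrow> (hardy2 \<Rightarrow> hardy2) \<Rightarrow> ereal" where
  "hs_norm M T =
     (let B = (SOME B. orthonormal_basis_of M B)
      in if (\<lambda>e. (norm (T e))\<^sup>2) summable_on B
         then ereal (sqrt (\<Sum>\<^sub>\<infinity>e\<in>B. (norm (T e))\<^sup>2)) else \<infinity>)"

text \<open>For a submodule \<open>M\<close> the restrictions of \<^const>\<open>mult_z\<close> and \<^const>\<open>mult_w\<close> to \<open>M\<close> are \<open>R\<^sub>z\<close> and
  \<open>R\<^sub>w\<close>; their adjoints are taken in \<open>M\<close>.\<close>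

definition cross_comm :: "hardy2 set \<Rightarrow> hardy2 \<Rightarrow> hardy2" where
  "cross_comm M f =
     (let Rz = mult_z; Rw = mult_w; Rz' = adjoint_on M mult_z
      in Rz' (Rw f) - Rw (Rz' f))"

definition core_op :: "hardy2 set \<Rightarrow> hardy2 \<Rightarrow> hardy2" where
  "core_op M f =
     (let Rz = mult_z; Rw = mult_w; Rz' = adjoint_on M mult_z; Rw' = adjoint_on M mult_w
      in f - Rz (Rz' f) - Rw (Rw' f) + Rz (Rw (Rz' (Rw' f))))"

end

theory Submission
  imports Defs "HOL-Real_Asymp.Real_Asymp"
begin

text \<open>\<open>M = [(z - w)\<^sup>N]\<close> is graded by degree.  In degree \<open>N + m\<close> the core operator vanishes on \<open>zw M\<close>,
  and on the complement, spanned by the generators \<open>U\<^sub>m\<close> and \<open>V\<^sub>m\<close> of \<open>M \<ominus> z M\<close> and \<open>M \<ominus> w M\<close>, it is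
  a sum of two rank one projections minus the identity; its eigenvalues are therefore \<open>\<plusminus>\<close> the cosine
  of the angle between \<open>U\<^sub>m\<close> and \<open>V\<^sub>m\<close>.  Dividing \<open>U\<^sub>m\<close> by \<open>(z - w)\<^sup>N\<close> gives the reversed orthogonal
  polynomial of degree \<open>m\<close> on the unit circle for the weight \<open>|1 - t|\<close> to the power \<open>2 N\<close>, \<open>V\<^sub>m\<close> is its
  mirror image, and the cosine is the Verblunsky coefficient \<open>N / (N + m)\<close>.  The cross commutator
  kills \<open>z M\<close>, and since \<open>w U\<^sub>m\<close> lies in the plane of \<open>U\<^bsub>m+1\<^esub>\<close> and \<open>V\<^bsub>m+1\<^esub>\<close> orthogonally to \<open>V\<^bsub>m+1\<^esub>\<close>, it
  scales the norm of \<open>U\<^sub>m\<close> by \<open>N / (N + m + 1)\<close>.\<close>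

text \<open>No norm and no determinant of a Gram matrix is ever evaluated. After division by (z -
  w)^N, the coefficient of z^m in \<open>vecU m\<close> is N / (N + m) times that of w^m, and
  \<open>vecV m\<close> has the same coefficients in reverse order. So U_m - N / (N + m) V_m has no
  z^m term, lies in w M, and is orthogonal to V_m: this alone gives the cosine, and its mirror image
  gives equality of the norms. The definitions are the other obstacle: \<open>hs_norm\<close> uses
  an unspecified orthonormal basis, \<open>adjoint_on\<close> a definite description and
  \<open>spectrum_on\<close> a bounded two-sided inverse. All three become accessible through one
  explicit orthonormal eigenbasis of the core operator, the normalised vectors (zw)^k (U_m + V_m)
  and (zw)^k (U_m - V_m). It is complete because U_m and V_m can cancel both end coefficients of a
  homogeneous element, which leaves a multiple of zw. Only k = 0 contributes to the two
  Hilbert-Schmidt norms, and the eigenvalues accumulate only at 0, the point removed from the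
  spectrum.\<close>

section \<open>Hilbert space geometry\<close>

lemma cinner_add_right: "cinner f (g + h) = cinner f g + cinner f h"
  by (metis cinner_commute cinner_add_left complex_cnj_add)

lemma cinner_scaleC_right: "cinner f (c *\<^sub>C g) = cnj c * cinner f g"
  by (metis cinner_commute cinner_scaleC_left complex_cnj_mult)

lemma cinner_zero_left [simp]: "cinner 0 f = 0"
  using cinner_scaleC_left[of 0 0 f] by simp

lemma cinner_zero_right [simp]: "cinner f 0 = 0"
  by (metis cinner_commute cinner_zero_left complex_cnj_zero)

lemma cinner_minus_left: "cinner (- f) g = - cinner f g"
  using cinner_add_left[of "- f" f g] by (simp add: eq_neg_iff_add_eq_0)

lemma cinner_minus_right: "cinner f (- g) = - cinner f g"
  by (metis cinner_commute cinner_minus_left complex_cnj_minus)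

lemma cinner_diff_left: "cinner (f - g) h = cinner f h - cinner g h"
  using cinner_add_left[of f "- g" h] by (simp add: cinner_minus_left)

lemma cinner_diff_right: "cinner f (g - h) = cinner f g - cinner f h"
  using cinner_add_right[of f g "- h"] by (simp add: cinner_minus_right)

lemma cinner_sum_left: "cinner (\<Sum>i\<in>I. f i) g = (\<Sum>i\<in>I. cinner (f i) g)"
  by (induction I rule: infinite_finite_induct) (simp_all add: cinner_add_left)

lemma cinner_sum_right: "cinner f (\<Sum>i\<in>I. g i) = (\<Sum>i\<in>I. cinner f (g i))"
  by (induction I rule: infinite_finite_induct) (simp_all add: cinner_add_right)

lemmas cinner_simps = cinner_add_left cinner_add_right cinner_scaleC_left cinner_scaleC_right
  cinner_minus_left cinner_minus_right cinner_diff_left cinner_diff_right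

lemma Re_cinner_self_norm: "Re (cinner f f) = (norm f)\<^sup>2"
  by (simp add: inner_hardy2_def power2_norm_eq_inner)

lemma cinner_self: "cinner f f = of_real ((norm f)\<^sup>2)"
  using Re_cinner_self_norm[of f] arg_cong[OF cinner_commute[of f f], of Im]
  by (simp add: complex_eq_iff)

lemma cinner_eq_zeroD: "cinner f f = 0 \<Longrightarrow> f = 0"
  by (simp add: cinner_self)

lemma norm_scaleC [simp]: "norm (c *\<^sub>C f) = cmod c * norm f"
proof -
  have "cinner (c *\<^sub>C f) (c *\<^sub>C f) = (c * cnj c) * cinner f f"
    by (simp add: cinner_simps)
  also have "\<dots> = of_real ((cmod c * norm f)\<^sup>2)"
    by (simp add: cinner_self complex_norm_square[symmetric] power_mult_distrib)
  finally have "(norm (c *\<^sub>C f))\<^sup>2 = (cmod c * norm f)\<^sup>2"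
    unfolding cinner_self of_real_eq_iff .
  then show ?thesis by (simp add: power2_eq_iff_nonneg)
qed

lemma cinner_cauchy_schwarz: "cmod (cinner f g) \<le> norm f * norm g"
proof (cases "cinner f g = 0")
  case False
  \<comment> \<open>Rotation by the opposite phase makes the inner product real and nonnegative, so
    that the real Cauchy-Schwarz inequality applies.\<close>
  define c where "c = cnj (cinner f g) / cmod (cinner f g)"
  have c: "cmod c = 1" using False by (simp add: c_def norm_divide)
  have "cinner (c *\<^sub>C f) g = of_real (cmod (cinner f g))"
    using False complex_norm_square[of "cinner f g"]
    by (simp add: c_def cinner_scaleC_left field_simps power2_eq_square)
  then have "cmod (cinner f g) = Re (cinner (c *\<^sub>C f) g)"
    by simp
  also have "\<dots> \<le> norm (c *\<^sub>C f) * norm g"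
    using norm_cauchy_schwarz[of "c *\<^sub>C f" g] by (simp add: inner_hardy2_def)
  finally show ?thesis using c by simp
qed simp

lemma bounded_linear_cinner_left: "bounded_linear (\<lambda>f. cinner f g)"
  by (rule bounded_linear_intro[of _ "norm g"])
    (simp_all add: cinner_simps scaleR_hardy2_def cinner_cauchy_schwarz scaleR_conv_of_real)

lemma bounded_linear_cinner_right: "bounded_linear (\<lambda>g. cinner f g)"
  by (rule bounded_linear_intro[of _ "norm f"])
    (simp_all add: cinner_simps scaleR_hardy2_def scaleR_conv_of_real,
      metis cinner_cauchy_schwarz mult.commute)

lemma bounded_linear_scaleC: "bounded_linear (scaleC c)"
  by (rule bounded_linear_intro[of _ "cmod c"])
    (simp_all add: scaleR_hardy2_def hardy2.scale_right_distrib mult.commute)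

lemma h2_coeff_diff [simp]: "h2_coeff (f - g) k = h2_coeff f k - h2_coeff g k"
  using h2_coeff_add[of "f - g" g k] by simp

lemma power2_norm_hardy2: "((\<lambda>k. (cmod (h2_coeff f k))\<^sup>2) has_sum (norm f)\<^sup>2) UNIV"
  using Re_cinner_self[of f] h2_coeff_sq_summable[of f] by (simp add: has_sum_iff Re_cinner_self_norm)

lemma sum_h2_coeff_le: "finite F \<Longrightarrow> (\<Sum>k\<in>F. (cmod (h2_coeff f k))\<^sup>2) \<le> (norm f)\<^sup>2"
  by (rule finite_sum_le_has_sum[OF power2_norm_hardy2]) auto

lemma h2_coeff_le: "cmod (h2_coeff f k) \<le> norm f"
  using sum_h2_coeff_le[of "{k}" f] by (simp add: power2_le_iff_abs_le)

section \<open>Completeness of the Hardy space\<close>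

text \<open>At each point of the bidisc the monomials \<open>z ^ i * w ^ j\<close> form a
  square-summable family, being a product of two geometric series; paired with the square-summable
  \<open>a\<close> they give a convergent power series.\<close>

lemma ex_h2_coeff:
  assumes a: "(\<lambda>k. (cmod (a k))\<^sup>2) summable_on UNIV"
  shows "\<exists>f. h2_coeff f = a"
proof -
  have ab: "(\<lambda>(i, j). a (i, j) * z ^ i * w ^ j) summable_on UNIV" if "(z, w) \<in> bidisc" for z w
  proof -
    have g: "(\<lambda>i. norm (x ^ i)^2) summable_on UNIV" if "norm x < 1" for x :: complex
    proof (rule summable_nonneg_imp_summable_on)
      have "(norm x)\<^sup>2 < 1" using that by (simp add: power_less_one_iff)
      moreover have "(\<lambda>i. norm (x ^ i)^2) = (\<lambda>i. ((norm x)\<^sup>2) ^ i)"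
        by (simp add: norm_power power_mult[symmetric] mult.commute)
      ultimately show "summable (\<lambda>i. norm (x ^ i)^2)"
        by (simp add: summable_geometric)
    qed auto
    have "(\<lambda>(i, j). norm (z ^ i)^2 * norm (w ^ j)^2) summable_on (UNIV \<times> UNIV)"
    proof (rule summable_on_SigmaI)
      fix i
      have "((\<lambda>j. norm (z ^ i)^2 * norm (w ^ j)^2) has_sum
          (norm (z ^ i)^2 * (\<Sum>\<^sub>\<infinity>j. norm (w ^ j)^2))) UNIV"
        using g[of w] that by (intro has_sum_cmult_right has_sum_infsum) (auto simp: bidisc_def)
      then show "((\<lambda>j. case (i, j) of (i, j) \<Rightarrow> norm (z ^ i)^2 * norm (w ^ j)^2) has_sum
          (norm (z ^ i)^2 * (\<Sum>\<^sub>\<infinity>j. norm (w ^ j)^2))) UNIV"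
        by simp
    next
      show "(\<lambda>i. norm (z ^ i)^2 * (\<Sum>\<^sub>\<infinity>j. norm (w ^ j)^2)) summable_on UNIV"
        using g[of z] that by (intro summable_on_cmult_left) (auto simp: bidisc_def)
    qed auto
    then have "(\<lambda>k. (cmod (cnj (z ^ fst k * w ^ snd k)))\<^sup>2) summable_on UNIV"
      by (simp add: case_prod_unfold norm_mult norm_power power_mult_distrib)
    from sq_summable_mult_cnj[OF a this] show ?thesis
      by (simp add: case_prod_unfold mult.assoc)
  qed
  define f where "f = (\<lambda>(z, w). if (z, w) \<in> bidisc
      then (\<Sum>\<^sub>\<infinity>(i, j). a (i, j) * z ^ i * w ^ j) else 0)"
  have t: "has_taylor f a"
    unfolding has_taylor_def f_def using ab by (auto intro!: has_sum_infsum)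
  then have "f \<in> hardy2_set"
    using a by (auto simp: hardy2_set_def f_def)
  then show ?thesis
    using t by (intro exI[of _ "Abs_hardy2 f"] h2_coeffI) (simp add: Abs_hardy2_inverse)
qed

instance hardy2 :: complete_space
proof
  fix X :: "nat \<Rightarrow> hardy2" assume X: "Cauchy X"
  have "Cauchy (\<lambda>n. h2_coeff (X n) k)" for k
    unfolding Cauchy_def
  proof (intro allI impI)
    fix e :: real assume "e > 0"
    then obtain M where "\<forall>m\<ge>M. \<forall>n\<ge>M. dist (X m) (X n) < e"
      using X unfolding Cauchy_def by blast
    then show "\<exists>M. \<forall>m\<ge>M. \<forall>n\<ge>M. dist (h2_coeff (X m) k) (h2_coeff (X n) k) < e"
      using h2_coeff_le[of "X _ - X _" k] by (metis dist_norm h2_coeff_diff le_less_trans)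
  qed
  then have "\<forall>k. \<exists>l. (\<lambda>n. h2_coeff (X n) k) \<longlonglongrightarrow> l"
    by (simp add: Cauchy_convergent_iff convergent_def)
  then obtain a where a: "\<And>k. (\<lambda>n. h2_coeff (X n) k) \<longlonglongrightarrow> a k" by metis
  \<comment> \<open>The Cauchy estimate passes to the coefficientwise limit on finite index sets; as
    the bound does not depend on \<open>F\<close>, it controls the full norm.\<close>
  have tail: "(\<Sum>k\<in>F. (cmod (a k - h2_coeff (X n) k))\<^sup>2) \<le> e\<^sup>2"
    if "finite F" "\<forall>m\<ge>n. dist (X m) (X n) \<le> e" for F n e
  proof (rule tendsto_upperbound)
    show "(\<lambda>m. \<Sum>k\<in>F. (cmod (h2_coeff (X m) k - h2_coeff (X n) k))\<^sup>2)
        \<longlonglongrightarrow> (\<Sum>k\<in>F. (cmod (a k - h2_coeff (X n) k))\<^sup>2)"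
      by (intro tendsto_intros a)
    have "(\<Sum>k\<in>F. (cmod (h2_coeff (X m) k - h2_coeff (X n) k))\<^sup>2) \<le> e\<^sup>2" if "m \<ge> n" for m
    proof -
      have "(\<Sum>k\<in>F. (cmod (h2_coeff (X m - X n) k))\<^sup>2) \<le> (norm (X m - X n))\<^sup>2"
        by (rule sum_h2_coeff_le) fact
      also have "\<dots> \<le> e\<^sup>2"
        using that \<open>\<forall>m\<ge>n. dist (X m) (X n) \<le> e\<close> by (intro power_mono) (auto simp: dist_norm)
      finally show ?thesis by simp
    qed
    then show "\<forall>\<^sub>F m in sequentially.
        (\<Sum>k\<in>F. (cmod (h2_coeff (X m) k - h2_coeff (X n) k))\<^sup>2) \<le> e\<^sup>2"
      by (auto simp: eventually_sequentially)
  qed auto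
  have ex: "\<exists>n0. \<forall>n\<ge>n0. \<forall>m\<ge>n. dist (X m) (X n) \<le> e" if "e > 0" for e
    using X that unfolding Cauchy_def by (meson le_trans less_imp_le)
  have "(\<lambda>k. (cmod (a k))\<^sup>2) summable_on UNIV"
  proof -
    obtain n where n: "\<forall>m\<ge>n. dist (X m) (X n) \<le> 1" using ex[of 1] by auto
    have "(\<lambda>k. (cmod (a k - h2_coeff (X n) k))\<^sup>2) summable_on UNIV"
      using tail[OF _ n] by (intro nonneg_bdd_above_summable_on bdd_aboveI[where M="1\<^sup>2"]) auto
    from sq_summable_add[OF this h2_coeff_sq_summable[of "X n"]] show ?thesis by simp
  qed
  then obtain f where f: "h2_coeff f = a" using ex_h2_coeff by blast
  have "X \<longlonglongrightarrow> f"
  proof (rule metric_LIMSEQ_I)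
    fix e :: real assume "e > 0"
    then obtain n0 where n0: "\<forall>n\<ge>n0. \<forall>m\<ge>n. dist (X m) (X n) \<le> e / 2"
      using ex[of "e/2"] by auto
    have "dist (X n) f < e" if "n \<ge> n0" for n
    proof -
      have "(norm (f - X n))\<^sup>2 \<le> (e/2)\<^sup>2"
        using tail[of _ n "e/2"] n0 that f
        by (intro has_sum_le_finite_sums[OF power2_norm_hardy2]) auto
      then have "norm (f - X n) \<le> e / 2" using \<open>e > 0\<close> by (simp add: power_mono_iff)
      then show ?thesis using \<open>e > 0\<close> by (simp add: dist_norm norm_minus_commute)
    qed
    then show "\<exists>n0. \<forall>n\<ge>n0. dist (X n) f < e" by blast
  qed
  then show "convergent X" by (auto simp: convergent_def)
qed

section \<open>Closed subspaces and orthonormal bases\<close>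

lemma subspace_closure:
  assumes "hardy2.subspace S"
  shows "hardy2.subspace (closure S)"
proof (rule hardy2.subspaceI)
  show "0 \<in> closure S"
    using hardy2.subspace_0[OF assms] closure_subset by blast
  show "f + g \<in> closure S" if fg: "f \<in> closure S" "g \<in> closure S" for f g
  proof -
    obtain X where "\<forall>n. X n \<in> S" "X \<longlonglongrightarrow> f"
      using fg(1) unfolding closure_sequential by metis
    moreover obtain Y where "\<forall>n. Y n \<in> S" "Y \<longlonglongrightarrow> g"
      using fg(2) unfolding closure_sequential by metis
    ultimately show ?thesis
      using hardy2.subspace_add[OF assms] unfolding closure_sequential
      by (intro exI[of _ "\<lambda>n. X n + Y n"]) (auto intro: tendsto_add)
  qed
  show "c *\<^sub>C f \<in> closure S" if f: "f \<in> closure S" for c f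
  proof -
    obtain X where "\<forall>n. X n \<in> S" "X \<longlonglongrightarrow> f"
      using f unfolding closure_sequential by metis
    then show ?thesis
      using hardy2.subspace_scale[OF assms] unfolding closure_sequential
      by (intro exI[of _ "\<lambda>n. c *\<^sub>C X n"])
        (auto intro: bounded_linear.tendsto[OF bounded_linear_scaleC])
  qed
qed

text \<open>The form in which density is used throughout: if the solutions of a condition form a
  closed subspace, the generators are enough to check.\<close>

lemma closure_span_induct:
  assumes "f \<in> closure (hardy2.span B)" "closed (Collect P)" "hardy2.subspace (Collect P)"
    and "\<And>e. e \<in> B \<Longrightarrow> P e"
  shows "P f"
proof -
  have "hardy2.span B \<subseteq> Collect P"
    using assms by (intro hardy2.span_minimal) auto
  then have "closure (hardy2.span B) \<subseteq> Collect P"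
    using assms(2) by (rule closure_minimal)
  then show ?thesis using assms(1) by auto
qed

lemma closed_bounded_linear_eq:
  fixes \<phi> :: "'a :: real_normed_vector \<Rightarrow> 'b :: real_normed_vector"
  assumes "bounded_linear \<phi>" "bounded_linear \<psi>"
  shows "closed {f. \<phi> f = \<psi> f}"
  using assms by (intro closed_Collect_eq) (auto intro: linear_continuous_on)

lemma cinner_closure_span_eq:
  assumes "g \<in> closure (hardy2.span B)" "\<And>e. e \<in> B \<Longrightarrow> cinner f e = cinner f' e"
  shows "cinner f g = cinner f' g"
  by (rule closure_span_induct[OF assms(1) closed_bounded_linear_eq])
    (auto intro!: bounded_linear_cinner_right hardy2.subspaceI simp: assms cinner_simps)

lemma orthonormal_basis_ofD:
  assumes "orthonormal_basis_of M B"
  shows "\<And>e e'. e \<in> B \<Longrightarrow> e' \<in> B \<Longrightarrow> cinner e e' = (if e = e' then 1 else 0)"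
    and "M = closure (hardy2.span B)" and "B \<subseteq> M" and "closed M" and "hardy2.subspace M"
  using assms hardy2.span_superset[of B] closure_subset[of "hardy2.span B"]
  by (auto simp: orthonormal_basis_of_def subspace_closure hardy2.subspace_span)

lemma orthonormal_basis_of_eqI:
  assumes "orthonormal_basis_of M B" "f \<in> M" "g \<in> M"
    and "\<And>e. e \<in> B \<Longrightarrow> cinner f e = cinner g e"
  shows "f = g"
proof -
  note B = orthonormal_basis_ofD[OF assms(1)]
  have "f - g \<in> M" using assms hardy2.subspace_diff[OF B(5)] by blast
  then have "cinner (f - g) (f - g) = cinner 0 (f - g)"
    unfolding B(2) by (rule cinner_closure_span_eq) (simp add: cinner_simps assms)
  then show ?thesis using cinner_eq_zeroD[of "f - g"] by simp
qed

lemma cinner_sum_orthonormal: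
  assumes "finite F" "\<And>i j. i \<in> F \<Longrightarrow> j \<in> F \<Longrightarrow> cinner (e i) (e j) = (if i = j then 1 else 0)"
    and "j \<in> F"
  shows "cinner (\<Sum>i\<in>F. a i *\<^sub>C e i) (e j) = a j"
proof -
  have "cinner (\<Sum>i\<in>F. a i *\<^sub>C e i) (e j) = (\<Sum>i\<in>F. if i = j then a i else 0)"
    unfolding cinner_sum_left cinner_simps using assms(2,3) by (intro sum.cong refl) auto
  then show ?thesis using assms by simp
qed

text \<open>Subtracting the projection \<open>p\<close> leaves a vector of squared norm
  \<open>(norm f)^2 - s\<close>. The orthonormal family is indexed, not a set, so that images
  \<open>T e\<close> of basis vectors under an isometry are covered.\<close>

lemma bessel_finite:
  assumes "finite F" "\<And>i j. i \<in> F \<Longrightarrow> j \<in> F \<Longrightarrow> cinner (e i) (e j) = (if i = j then 1 else 0)"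
  shows "(\<Sum>i\<in>F. (cmod (cinner f (e i)))\<^sup>2) \<le> (norm f)\<^sup>2"
proof -
  define p where "p = (\<Sum>i\<in>F. cinner f (e i) *\<^sub>C e i)"
  define s where "s = (\<Sum>i\<in>F. (cmod (cinner f (e i)))\<^sup>2)"
  have pe: "cinner p (e j) = cinner f (e j)" if "j \<in> F" for j
    unfolding p_def by (rule cinner_sum_orthonormal[OF assms that])
  have fp: "cinner f p = of_real s"
    by (simp add: p_def s_def cinner_sum_right cinner_simps complex_norm_square mult.commute
        del: of_real_power)
  have pp: "cinner p p = of_real s"
    unfolding p_def s_def cinner_sum_right cinner_simps of_real_sum complex_norm_square
    by (intro sum.cong refl) (simp add: pe[unfolded p_def] mult.commute)
  have pf: "cinner p f = of_real s"
    using cinner_commute[of p f] fp by simp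
  have "cinner (f - p) (f - p) = of_real ((norm f)\<^sup>2 - s)"
    by (simp add: cinner_simps fp pp pf cinner_self[of f] del: of_real_power)
  then have "(norm (f - p))\<^sup>2 = (norm f)\<^sup>2 - s"
    unfolding cinner_self of_real_eq_iff .
  then show ?thesis using zero_le_power2[of "norm (f - p)"] by (simp add: s_def)
qed

text \<open>No enumeration of \<open>B\<close> is assumed, since the basis inside
  \<open>hs_norm\<close> is arbitrary; partial sums are taken along the filter of finite subsets,
  where orthogonality reduces the Cauchy property to that of the scalar sums.\<close>

lemma riesz_fischer:
  assumes on: "\<And>e e'. e \<in> B \<Longrightarrow> e' \<in> B \<Longrightarrow> cinner e e' = (if e = e' then 1 else 0)"
    and a: "(\<lambda>e. (cmod (a e))\<^sup>2) summable_on B"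
  shows "\<exists>h \<in> closure (hardy2.span B). ((\<lambda>e. a e *\<^sub>C e) has_sum h) B \<and> (\<forall>e\<in>B. cinner h e = a e)"
proof -
  define g where "g F = (\<Sum>e\<in>F. a e *\<^sub>C e)" for F
  have norm_g: "(norm (g F))\<^sup>2 = (\<Sum>e\<in>F. (cmod (a e))\<^sup>2)" if "finite F" "F \<subseteq> B" for F
  proof -
    have "cinner (g F) e = a e" if "e \<in> F" for e
      unfolding g_def using that \<open>finite F\<close> \<open>F \<subseteq> B\<close> on
      by (intro cinner_sum_orthonormal[where e="\<lambda>e. e"] on) auto
    then have "cinner (g F) (g F) = of_real (\<Sum>e\<in>F. (cmod (a e))\<^sup>2)"
      unfolding g_def[of F] cinner_sum_right cinner_simps of_real_sum complex_norm_square
      by (intro sum.cong refl) (simp add: g_def mult.commute)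
    then show ?thesis unfolding cinner_self of_real_eq_iff .
  qed
  have "cauchy_filter (filtermap g (finite_subsets_at_top B))"
    unfolding cauchy_filter_metric_filtermap
  proof (intro allI impI)
    fix \<epsilon> :: real assume "\<epsilon> > 0"
    let ?s = "sum (\<lambda>e. (cmod (a e))\<^sup>2)"
    let ?L = "\<Sum>\<^sub>\<infinity>e\<in>B. (cmod (a e))\<^sup>2"
    \<comment> \<open>Two partial sums containing \<open>F0\<close> are each within a third of
      \<open>\<epsilon>\<close> of \<open>g F0\<close>, hence strictly within
      \<open>\<epsilon>\<close> of each other.\<close>
    obtain F0 where F0: "finite F0" "F0 \<subseteq> B" "dist (?s F0) ?L \<le> (\<epsilon>/3)\<^sup>2"
      using has_sum_finite_approximation[OF has_sum_infsum[OF a], of "(\<epsilon>/3)\<^sup>2"] \<open>\<epsilon> > 0\<close> by auto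
    have *: "dist (g F) (g F0) \<le> \<epsilon> / 3" if F: "finite F" "F0 \<subseteq> F" "F \<subseteq> B" for F
    proof -
      have "(norm (g F - g F0))\<^sup>2 = (norm (g (F - F0)))\<^sup>2"
        using F by (simp add: g_def sum_diff)
      also have "\<dots> = ?s F - ?s F0"
        using F by (subst norm_g) (auto simp: sum_diff)
      also have "\<dots> \<le> (\<epsilon>/3)\<^sup>2"
        using finite_sum_le_infsum[OF a, of F] F F0 by (auto simp: dist_real_def)
      finally show ?thesis using \<open>\<epsilon> > 0\<close> by (simp add: dist_norm power2_le_iff_abs_le)
    qed
    have "dist (g F1) (g F2) < \<epsilon>"
      if "finite F1" "F0 \<subseteq> F1" "F1 \<subseteq> B" "finite F2" "F0 \<subseteq> F2" "F2 \<subseteq> B" for F1 F2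
      using *[of F1] *[of F2] that dist_triangle2[of "g F1" "g F2" "g F0"] \<open>\<epsilon> > 0\<close> by auto
    then show "\<exists>P. eventually P (finite_subsets_at_top B) \<and>
        (\<forall>x y. P x \<and> P y \<longrightarrow> dist (g x) (g y) < \<epsilon>)"
      using F0
      by (intro exI[of _ "\<lambda>F. finite F \<and> F0 \<subseteq> F \<and> F \<subseteq> B"])
        (auto simp: eventually_finite_subsets_at_top)
  qed
  moreover have "complete (UNIV :: hardy2 set)" by (rule complete_UNIV)
  ultimately obtain h where h: "(g \<longlongrightarrow> h) (finite_subsets_at_top B)"
    using complete_uniform[where S="UNIV :: hardy2 set"] by (force simp add: filterlim_def)
  have "g F \<in> hardy2.span B" if "F \<subseteq> B" for F
    unfolding g_def using that by (intro hardy2.span_sum hardy2.span_scale hardy2.span_base) auto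
  then have "h \<in> closure (hardy2.span B)"
    using closure_subset[of "hardy2.span B"]
    by (intro Lim_in_closed_set[OF closed_closure _ _ h])
      (auto intro!: eventually_finite_subsets_at_top_weakI)
  moreover have hs: "((\<lambda>e. a e *\<^sub>C e) has_sum h) B"
    using h by (simp add: has_sum_def g_def[abs_def])
  moreover have "cinner h e = a e" if "e \<in> B" for e
  proof (rule has_sum_unique)
    show "((\<lambda>e'. cinner (a e' *\<^sub>C e') e) has_sum cinner h e) B"
      using has_sum_bounded_linear[OF bounded_linear_cinner_left hs] .
    show "((\<lambda>e'. cinner (a e' *\<^sub>C e') e) has_sum a e) B"
      using that on by (intro has_sum_finite_neutralI[of "{e}"]) (auto simp: cinner_simps)
  qed
  ultimately show ?thesis by blast
qed

lemma bessel_summable: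
  assumes "\<And>i j. i \<in> I \<Longrightarrow> j \<in> I \<Longrightarrow> cinner (e i) (e j) = (if i = j then 1 else 0)"
  shows "(\<lambda>i. (cmod (cinner f (e i)))\<^sup>2) summable_on I"
proof (rule nonneg_bdd_above_summable_on)
  show "bdd_above (sum (\<lambda>i. (cmod (cinner f (e i)))\<^sup>2) ` {F. F \<subseteq> I \<and> finite F})"
    by (rule bdd_aboveI[of _ "(norm f)\<^sup>2"]) (auto intro!: bessel_finite assms)
qed auto

text \<open>Prescribing coordinates is how both adjoints and resolvents are constructed
  below.\<close>

lemma orthonormal_basis_of_ex:
  assumes "orthonormal_basis_of M B" "(\<lambda>e. (cmod (a e))\<^sup>2) summable_on B"
  shows "\<exists>!h. h \<in> M \<and> (\<forall>e\<in>B. cinner h e = a e)"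
  using riesz_fischer[OF orthonormal_basis_ofD(1)[OF assms(1)] assms(2)]
    orthonormal_basis_of_eqI[OF assms(1)] orthonormal_basis_ofD(2)[OF assms(1)]
  by (metis (lifting))

lemma parseval:
  assumes "orthonormal_basis_of M B" "f \<in> M"
  shows "((\<lambda>e. (cmod (cinner f e))\<^sup>2) has_sum (norm f)\<^sup>2) B"
proof -
  note B = orthonormal_basis_ofD[OF assms(1)]
  obtain h where h: "h \<in> M" "((\<lambda>e. cinner f e *\<^sub>C e) has_sum h) B" "\<forall>e\<in>B. cinner h e = cinner f e"
    using riesz_fischer[OF B(1) bessel_summable[OF B(1)], of _ f] B(2) by blast
  have "h = f"
    using h assms by (intro orthonormal_basis_of_eqI[OF assms(1)]) auto
  have "((\<lambda>e. cinner (cinner f e *\<^sub>C e) f) has_sum cinner f f) B"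
    using has_sum_bounded_linear[OF bounded_linear_cinner_left h(2)] \<open>h = f\<close> by simp
  moreover have "cinner (cinner f e *\<^sub>C e) f = of_real ((cmod (cinner f e))\<^sup>2)" for e
    unfolding cinner_simps complex_norm_square using cinner_commute[of e f] by simp
  ultimately show ?thesis
    by (simp add: cinner_self has_sum_of_real_iff del: of_real_power)
qed

section \<open>Adjoints, Hilbert-Schmidt norm and spectrum in coordinates\<close>

text \<open>Two candidates have the same inner product with their own difference, which is therefore
  zero. Every concrete value of an adjoint is obtained by guessing \<open>h\<close> and checking the
  identity.\<close>

lemma adjoint_on_eqI:
  assumes "hardy2.subspace M" "h \<in> M" "\<And>f. f \<in> M \<Longrightarrow> cinner (T f) g = cinner f h"
  shows "adjoint_on M T g = h"
  unfolding adjoint_on_def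
proof (rule the_equality)
  fix h' assume h': "h' \<in> M \<and> (\<forall>f\<in>M. cinner (T f) g = cinner f h')"
  have "h' - h \<in> M" using h' assms hardy2.subspace_diff by blast
  then have "cinner (h' - h) h' = cinner (h' - h) h"
    using h' assms(3) by metis
  then have "cinner (h' - h) (h' - h) = 0" by (simp add: cinner_diff_right)
  then show "h' = h" using cinner_eq_zeroD by fastforce
qed (use assms in auto)

text \<open>An isometry maps the basis to an orthonormal family, so Bessel's inequality makes the
  required coordinates of the adjoint square-summable. The vector \<open>g\<close> may lie outside
  \<open>M\<close>.\<close>

lemma adjoint_on_isometry:
  assumes M: "orthonormal_basis_of M B"
    and T: "bounded_linear T" "\<And>c f. T (c *\<^sub>C f) = c *\<^sub>C T f" "\<And>f g. cinner (T f) (T g) = cinner f g"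
  shows "adjoint_on M T g \<in> M"
    and "\<And>f. f \<in> M \<Longrightarrow> cinner (T f) g = cinner f (adjoint_on M T g)"
proof -
  note B = orthonormal_basis_ofD[OF M]
  interpret T: bounded_linear T by fact
  have summable: "(\<lambda>e. (cmod (cinner g (T e)))\<^sup>2) summable_on B"
    by (rule bessel_summable) (simp add: T B(1))
  obtain h where h: "h \<in> M" "\<And>e. e \<in> B \<Longrightarrow> cinner h e = cinner g (T e)"
    using orthonormal_basis_of_ex[OF M summable] by blast
  have eq: "cinner (T f) g = cinner f h" if "f \<in> M" for f
    using that unfolding B(2)
  proof (rule closure_span_induct)
    show "closed {f. cinner (T f) g = cinner f h}"
      by (intro closed_bounded_linear_eq bounded_linear_cinner_left
          bounded_linear_compose[OF bounded_linear_cinner_left T(1)])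
    show "hardy2.subspace {f. cinner (T f) g = cinner f h}"
      by (rule hardy2.subspaceI) (auto simp: T.add T.zero T(2) cinner_simps)
    show "cinner (T e) g = cinner e h" if "e \<in> B" for e
      using h(2)[OF that] cinner_commute[of "T e" g] cinner_commute[of e h] by simp
  qed
  then have "adjoint_on M T g = h"
    using B(5) h(1) by (intro adjoint_on_eqI) auto
  then show "adjoint_on M T g \<in> M"
    "\<And>f. f \<in> M \<Longrightarrow> cinner (T f) g = cinner f (adjoint_on M T g)"
    using eq h(1) by auto
qed

text \<open>By Parseval, the double series of \<open>(cmod (cinner (T e) e'))^2\<close> has row sums
  \<open>(norm (T e))^2\<close> and column sums \<open>(norm (T' e'))^2\<close>; nonnegativity
  permits exchanging the order.\<close>

lemma hs_swap:
  assumes B: "orthonormal_basis_of M B" "orthonormal_basis_of M B'"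
    and T: "\<And>f. f \<in> M \<Longrightarrow> T f \<in> M" "\<And>f. f \<in> M \<Longrightarrow> T' f \<in> M"
      "\<And>f g. f \<in> M \<Longrightarrow> g \<in> M \<Longrightarrow> cinner (T f) g = cinner f (T' g)"
    and s: "((\<lambda>e. (norm (T e))\<^sup>2) has_sum s) B"
  shows "((\<lambda>e. (norm (T' e))\<^sup>2) has_sum s) B'"
proof -
  have BM: "B \<subseteq> M" "B' \<subseteq> M" using orthonormal_basis_ofD(3) B by blast+
  define c where "c = (\<lambda>(e, e'). (cmod (cinner (T e) e'))\<^sup>2)"
  have row: "((\<lambda>e'. c (e, e')) has_sum (norm (T e))\<^sup>2) B'" if "e \<in> B" for e
    using parseval[OF B(2), of "T e"] T(1) that BM by (auto simp: c_def)
  have summable: "c summable_on B \<times> B'"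
    by (rule summable_on_SigmaI[OF row]) (use s in \<open>auto simp: summable_on_def c_def\<close>)
  have "(c has_sum s) (B \<times> B')"
    by (rule has_sum_SigmaI[OF row s summable])
  then have "((\<lambda>(e', e). c (e, e')) has_sum s) (B' \<times> B)"
    by (subst (asm) has_sum_swap) (simp add: case_prod_unfold)
  then show ?thesis
  proof (rule has_sum_SigmaD)
    fix e' assume e': "e' \<in> B'"
    have "((\<lambda>e. (cmod (cinner (T' e') e))\<^sup>2) has_sum (norm (T' e'))\<^sup>2) B"
      using parseval[OF B(1), of "T' e'"] T(2) e' BM by auto
    moreover have "(cmod (cinner (T' e') e))\<^sup>2 = c (e, e')" if "e \<in> B" for e
    proof -
      have "cinner (T e) e' = cnj (cinner (T' e') e)"
        using T(3)[of e e'] that e' BM cinner_commute[of e "T' e'"] by auto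
      then show ?thesis by (simp add: c_def)
    qed
    ultimately show "((\<lambda>e. case (e', e) of (e', e) \<Rightarrow> c (e, e')) has_sum (norm (T' e'))\<^sup>2) B"
      by (simp cong: has_sum_cong)
  qed
qed

lemma hs_norm_eqI:
  assumes B: "orthonormal_basis_of M B"
    and T: "\<And>f. f \<in> M \<Longrightarrow> T f \<in> M" "\<And>f. f \<in> M \<Longrightarrow> T' f \<in> M"
      "\<And>f g. f \<in> M \<Longrightarrow> g \<in> M \<Longrightarrow> cinner (T f) g = cinner f (T' g)"
    and s: "((\<lambda>e. (norm (T e))\<^sup>2) has_sum s) B"
  shows "hs_norm M T = ereal (sqrt s)"
proof -
  define B' where "B' = (SOME B. orthonormal_basis_of M B)"
  have B': "orthonormal_basis_of M B'"
    unfolding B'_def using B by (rule someI)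
  have T': "cinner (T' f) g = cinner f (T g)" if "f \<in> M" "g \<in> M" for f g
    using T(3)[OF that(2,1)] by (metis cinner_commute)
  \<comment> \<open>The swap is applied twice: first from \<open>T\<close> to \<open>T'\<close>
    within the basis \<open>B\<close>, then back from \<open>T'\<close> to \<open>T\<close> while
    moving to the chosen basis \<open>B'\<close>.\<close>
  have s': "((\<lambda>e. (norm (T' e))\<^sup>2) has_sum s) B"
    by (rule hs_swap[OF B B T s])
  have "((\<lambda>e. (norm (T e))\<^sup>2) has_sum s) B'"
    by (rule hs_swap[where T=T' and T'=T, OF B B' T(2,1) T' s'])
  then show ?thesis
    by (simp add: hs_norm_def B'_def[symmetric] has_sum_iff)
qed

text \<open>Away from the closure of the eigenvalues the resolvent divides coordinates by
  \<open>\<mu> e - c\<close>, and a positive distance \<open>\<delta>\<close> bounds it by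
  \<open>1 / \<delta>\<close>. Eigenvalues themselves need not form a closed set, hence the two
  inclusions.\<close>

lemma spectrum_on_diagonal:
  assumes B: "orthonormal_basis_of M B"
    and T: "\<And>f. f \<in> M \<Longrightarrow> T f \<in> M" "\<And>f e. f \<in> M \<Longrightarrow> e \<in> B \<Longrightarrow> cinner (T f) e = \<mu> e * cinner f e"
  shows "\<mu> ` B \<subseteq> spectrum_on M T" and "spectrum_on M T \<subseteq> closure (\<mu> ` B)"
proof -
  note BD = orthonormal_basis_ofD[OF B]
  note M = hardy2.subspace_add[OF BD(5)] hardy2.subspace_diff[OF BD(5)]
    hardy2.subspace_scale[OF BD(5)]
  show "\<mu> ` B \<subseteq> spectrum_on M T"
  proof safe
    fix e assume e: "e \<in> B"
    have "T e = \<mu> e *\<^sub>C e"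
      by (rule orthonormal_basis_of_eqI[OF B])
        (use e BD(1,3) T M in \<open>auto simp: cinner_simps\<close>)
    \<comment> \<open>A left inverse of \<open>T\<close> minus its eigenvalue would have to send 0
      back to the eigenvector \<open>e\<close>.\<close>
    moreover have False if "bounded_op_on M S" "S 0 = e" for S
    proof -
      have "S (0 *\<^sub>C e) = 0 *\<^sub>C S e"
        using that(1) e BD(3) unfolding bounded_op_on_def by blast
      then have "e = 0" using that(2) by simp
      then show False using BD(1)[OF e e] by simp
    qed
    ultimately show "\<mu> e \<in> spectrum_on M T"
      using e BD(3) unfolding spectrum_on_def by fastforce
  qed
  show "spectrum_on M T \<subseteq> closure (\<mu> ` B)"
  proof (rule ccontr)
    assume "\<not> ?thesis"
    then obtain c where c: "c \<in> spectrum_on M T" "c \<notin> closure (\<mu> ` B)" by blast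
    then obtain \<delta> where \<delta>: "\<delta> > 0" "\<And>e. e \<in> B \<Longrightarrow> cmod (\<mu> e - c) \<ge> \<delta>"
      by (auto simp: closure_approachable dist_norm not_less)
    then have nz: "\<mu> e - c \<noteq> 0" if "e \<in> B" for e using that by fastforce
    have bound: "(cmod (cinner f e / (\<mu> e - c)))\<^sup>2 \<le> (1/\<delta>)\<^sup>2 * (cmod (cinner f e))\<^sup>2" if "e \<in> B" for e f
      using \<delta> that by (simp add: norm_divide power_divide divide_simps power_mono mult_mono)
    define S where "S f = (THE h. h \<in> M \<and> (\<forall>e\<in>B. cinner h e = cinner f e / (\<mu> e - c)))" for f
    have S: "S f \<in> M \<and> (\<forall>e\<in>B. cinner (S f) e = cinner f e / (\<mu> e - c))" if "f \<in> M" for f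
      unfolding S_def
    proof (rule theI'[OF orthonormal_basis_of_ex[OF B]])
      show "(\<lambda>e. (cmod (cinner f e / (\<mu> e - c)))\<^sup>2) summable_on B"
        by (rule summable_on_comparison_test[OF _ bound])
          (use parseval[OF B that] in \<open>auto intro: summable_on_cmult_right has_sum_imp_summable\<close>)
    qed
    have "norm (S f) \<le> 1/\<delta> * norm f" if "f \<in> M" for f
    proof -
      have "((\<lambda>e. (cmod (cinner f e / (\<mu> e - c)))\<^sup>2) has_sum (norm (S f))\<^sup>2) B"
        using parseval[OF B, of "S f"] S[OF that] by (simp cong: has_sum_cong)
      then have "(norm (S f))\<^sup>2 \<le> (1/\<delta>)\<^sup>2 * (norm f)\<^sup>2"
        using has_sum_cmult_right[OF parseval[OF B that]] bound by (rule has_sum_mono)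
      then show ?thesis
        using \<delta>(1) by (simp add: power_mult_distrib[symmetric] power2_le_iff_abs_le del: power_one_over)
    qed
    moreover have "S (f + g) = S f + S g" if "f \<in> M" "g \<in> M" for f g
      by (rule orthonormal_basis_of_eqI[OF B])
        (use S that M in \<open>auto simp: cinner_simps add_divide_distrib\<close>)
    moreover have "S (k *\<^sub>C f) = k *\<^sub>C S f" if "f \<in> M" for f k
      by (rule orthonormal_basis_of_eqI[OF B]) (use S that M in \<open>auto simp: cinner_simps\<close>)
    ultimately have "bounded_op_on M S"
      unfolding bounded_op_on_def using S by blast
    moreover have "S (T f - c *\<^sub>C f) = f" if "f \<in> M" for f
      by (rule orthonormal_basis_of_eqI[OF B])
        (use S that M T nz in \<open>auto simp: cinner_simps left_diff_distrib[symmetric]\<close>)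
    moreover have "T (S f) - c *\<^sub>C S f = f" if "f \<in> M" for f
      by (rule orthonormal_basis_of_eqI[OF B])
        (use S that M T nz in \<open>auto simp: cinner_simps left_diff_distrib[symmetric]
          diff_divide_distrib[symmetric]\<close>)
    ultimately show False using c(1) unfolding spectrum_on_def by blast
  qed
qed

section \<open>Gram matrix of the generators\<close>

text \<open>Treats both variables at once: \<open>mult_z\<close> is the case (1, 0) of
  \<open>(p, q)\<close> and \<open>mult_w\<close> the case (0, 1).\<close>

lemma has_taylor_shift:
  assumes "has_taylor f a"
  shows "has_taylor (\<lambda>(z, w). z ^ p * w ^ q * f (z, w))
      (\<lambda>(i, j). if p \<le> i \<and> q \<le> j then a (i - p, j - q) else 0)"
proof -
  define b where "b = (\<lambda>(i, j). if p \<le> i \<and> q \<le> j then a (i - p, j - q) else 0)"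
  have "has_taylor (\<lambda>(z, w). z ^ p * w ^ q * f (z, w)) b"
    unfolding has_taylor_def
  proof clarify
    fix z w assume "(z, w) \<in> bidisc"
    then have "((\<lambda>(i, j). a (i, j) * z ^ i * w ^ j) has_sum f (z, w)) UNIV"
      using assms by (auto simp: has_taylor_def)
    then have "((\<lambda>k. z ^ p * w ^ q * (case k of (i, j) \<Rightarrow> a (i, j) * z ^ i * w ^ j)) has_sum
        z ^ p * w ^ q * f (z, w)) UNIV"
      by (rule has_sum_cmult_right)
    also have "?this \<longleftrightarrow> ((\<lambda>(i, j). b (i, j) * z ^ i * w ^ j) has_sum z ^ p * w ^ q * f (z, w))
        {(i, j). p \<le> i \<and> q \<le> j}"
      by (rule has_sum_reindex_bij_witness[of _ "\<lambda>(i, j). (i - p, j - q)" "\<lambda>(i, j). (i + p, j + q)"])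
        (auto simp: b_def power_add mult_ac)
    also have "\<dots> \<longleftrightarrow> ((\<lambda>(i, j). b (i, j) * z ^ i * w ^ j) has_sum z ^ p * w ^ q * f (z, w)) UNIV"
      by (rule has_sum_cong_neutral) (auto simp: b_def split: if_splits)
    finally show "((\<lambda>(i, j). b (i, j) * z ^ i * w ^ j) has_sum z ^ p * w ^ q * f (z, w)) UNIV" .
  qed
  then show ?thesis by (simp add: b_def)
qed

lemma cinner_shift:
  assumes "h2_coeff f' = (\<lambda>(i, j). if p \<le> i \<and> q \<le> j then h2_coeff f (i - p, j - q) else 0)"
    and "h2_coeff g' = (\<lambda>(i, j). if p \<le> i \<and> q \<le> j then h2_coeff g (i - p, j - q) else 0)"
  shows "cinner f' g' = cinner f g"
proof -
  have "cinner f' g' = (\<Sum>\<^sub>\<infinity>k\<in>{(i, j). p \<le> i \<and> q \<le> j}. h2_coeff f' k * cnj (h2_coeff g' k))"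
    unfolding cinner_def by (rule infsum_cong_neutral) (auto simp: assms split: if_splits)
  also have "\<dots> = cinner f g"
    unfolding cinner_def
    by (rule infsum_reindex_bij_witness[of _ "\<lambda>(i, j). (i + p, j + q)" "\<lambda>(i, j). (i - p, j - q)"])
      (auto simp: assms)
  finally show ?thesis .
qed

section \<open>Multiplication by the variables as commuting isometries\<close>

text \<open>The vacuous \<open>0 \<le> j\<close> and \<open>j - 0\<close> keep the shape that
  \<open>cinner_shift\<close> expects.\<close>

lemma h2_coeff_mult_z:
  "h2_coeff (mult_z f) = (\<lambda>(i, j). if 1 \<le> i \<and> 0 \<le> j then h2_coeff f (i - 1, j - 0) else 0)"
  using has_taylor_shift[OF has_taylor_h2_coeff[of f], of 1 0]
  by (intro h2_coeffI) (simp add: mult_z.rep_eq)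

lemma cinner_mult_z [simp]: "cinner (mult_z f) (mult_z g) = cinner f g"
  by (rule cinner_shift[OF h2_coeff_mult_z h2_coeff_mult_z])

lemma h2_coeff_mult_w:
  "h2_coeff (mult_w f) = (\<lambda>(i, j). if 0 \<le> i \<and> 1 \<le> j then h2_coeff f (i - 0, j - 1) else 0)"
  using has_taylor_shift[OF has_taylor_h2_coeff[of f], of 0 1]
  by (intro h2_coeffI) (simp add: mult_w.rep_eq)

lemma cinner_mult_w [simp]: "cinner (mult_w f) (mult_w g) = cinner f g"
  by (rule cinner_shift[OF h2_coeff_mult_w h2_coeff_mult_w])

lemma mult_z_add: "mult_z (f + g) = mult_z f + mult_z g"
  and mult_z_scaleC: "mult_z (c *\<^sub>C f) = c *\<^sub>C mult_z f"
  and mult_w_add: "mult_w (f + g) = mult_w f + mult_w g"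
  and mult_w_scaleC: "mult_w (c *\<^sub>C f) = c *\<^sub>C mult_w f"
  and mult_z_mult_w: "mult_z (mult_w f) = mult_w (mult_z f)"
  by (transfer; auto simp: fun_eq_iff algebra_simps)+

lemma norm_mult_z [simp]: "norm (mult_z f) = norm f"
proof -
  have "(norm (mult_z f))\<^sup>2 = (norm f)\<^sup>2"
    by (simp only: Re_cinner_self_norm[symmetric] cinner_mult_z)
  then show ?thesis by (simp add: power2_eq_iff_nonneg)
qed

lemma norm_mult_w [simp]: "norm (mult_w f) = norm f"
proof -
  have "(norm (mult_w f))\<^sup>2 = (norm f)\<^sup>2"
    by (simp only: Re_cinner_self_norm[symmetric] cinner_mult_w)
  then show ?thesis by (simp add: power2_eq_iff_nonneg)
qed

lemma bounded_linear_mult_z: "bounded_linear mult_z"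
  by (rule bounded_linear_intro[of _ 1]) (simp_all add: mult_z_add mult_z_scaleC scaleR_hardy2_def)

lemma bounded_linear_mult_w: "bounded_linear mult_w"
  by (rule bounded_linear_intro[of _ 1]) (simp_all add: mult_w_add mult_w_scaleC scaleR_hardy2_def)

lemmas mult_z_0 [simp] = bounded_linear.linear[OF bounded_linear_mult_z, THEN linear_0]
lemmas mult_w_0 [simp] = bounded_linear.linear[OF bounded_linear_mult_w, THEN linear_0]
lemmas mult_z_sum = bounded_linear.linear[OF bounded_linear_mult_z, THEN linear_sum]
lemmas mult_w_sum = bounded_linear.linear[OF bounded_linear_mult_w, THEN linear_sum]

lemma hardy2_eqI: "(\<And>z w. h2_fun f (z, w) = h2_fun g (z, w)) \<Longrightarrow> f = g"
  by (simp add: h2_fun_inject[symmetric] fun_eq_iff)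

lemma h2_poly_add: "h2_poly (p + q) = h2_poly p + h2_poly q"
  by (rule hardy2_eqI) (simp add: h2_poly.rep_eq plus_hardy2.rep_eq eval2_def)

lemma h2_poly_diff: "h2_poly (p - q) = h2_poly p - h2_poly q"
  by (rule hardy2_eqI) (simp add: h2_poly.rep_eq minus_hardy2.rep_eq eval2_def)

lemma h2_poly_const_mult: "h2_poly ([:[:c:]:] * p) = c *\<^sub>C h2_poly p"
  by (rule hardy2_eqI) (simp add: h2_poly.rep_eq scaleC.rep_eq eval2_def)

lemma h2_poly_var_z: "h2_poly (var_z * p) = mult_z (h2_poly p)"
  by (rule hardy2_eqI) (simp add: h2_poly.rep_eq mult_z.rep_eq eval2_def var_z_def)

lemma h2_poly_var_w: "h2_poly (var_w * p) = mult_w (h2_poly p)"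
  by (rule hardy2_eqI) (simp add: h2_poly.rep_eq mult_w.rep_eq eval2_def var_w_def)

lemma h2_poly_0 [simp]: "h2_poly 0 = 0"
  by (rule hardy2_eqI) (simp add: h2_poly.rep_eq zero_hardy2.rep_eq eval2_def)

text \<open>These span the polynomial part of the submodule; each is homogeneous of degree
  \<open>N + i + j\<close>, which is the source of the grading. The outer index \<open>j\<close> is
  the exponent of w.\<close>

definition diag_gen :: "nat \<Rightarrow> nat \<Rightarrow> nat \<Rightarrow> hardy2" where
  "diag_gen N i j = h2_poly ((var_z - var_w) ^ N * monom (monom 1 i) j)"

lemma var_z_mult_monom: "var_z * monom (monom 1 i) j = monom (monom 1 (Suc i)) j"
  by (intro poly_eqI) (simp add: var_z_def coeff_pCons split: nat.split)

lemma var_w_mult_monom: "var_w * monom (monom 1 i) j = monom (monom 1 i) (Suc j)"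
  by (simp add: var_w_def monom_Suc)

lemma mult_z_diag_gen: "mult_z (diag_gen N i j) = diag_gen N (Suc i) j"
  by (simp add: diag_gen_def h2_poly_var_z[symmetric] var_z_mult_monom[symmetric] mult.left_commute)

lemma mult_w_diag_gen: "mult_w (diag_gen N i j) = diag_gen N i (Suc j)"
  by (simp add: diag_gen_def h2_poly_var_w[symmetric] var_w_mult_monom[symmetric] mult.left_commute)

lemma diag_gen_Suc: "diag_gen (Suc N) i j = diag_gen N (Suc i) j - diag_gen N i (Suc j)"
  by (simp add: diag_gen_def var_z_mult_monom[symmetric] var_w_mult_monom[symmetric]
      h2_poly_diff[symmetric] algebra_simps)

lemma h2_coeff_monom: "h2_coeff (diag_gen 0 i j) = (\<lambda>k. if k = (i, j) then 1 else 0)"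
proof (rule h2_coeffI)
  show "has_taylor (h2_fun (diag_gen 0 i j)) (\<lambda>k. if k = (i, j) then 1 else 0)"
    unfolding has_taylor_def
  proof clarify
    fix z w assume zw: "(z, w) \<in> bidisc"
    have "h2_fun (diag_gen 0 i j) (z, w) = z ^ i * w ^ j"
      using zw by (simp add: diag_gen_def h2_poly.rep_eq eval2_def poly_monom)
    then show "((\<lambda>(i', j'). (if (i', j') = (i, j) then 1 else 0) * z ^ i' * w ^ j') has_sum
        h2_fun (diag_gen 0 i j) (z, w)) UNIV"
      by (intro has_sum_finite_neutralI[of "{(i, j)}"]) (auto split: if_splits)
  qed
qed

text \<open>The Fourier coefficients of |1 - t|^(2N) = (2 - t - 1/t)^N on the unit circle, that is,
  (-1)^d times the binomial coefficient of 2N over N + d. Convolution with \<open>tau N\<close> is,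
  up to sign, the central difference of order 2N.\<close>

primrec tau :: "nat \<Rightarrow> int \<Rightarrow> real" where
  "tau 0 d = (if d = 0 then 1 else 0)"
| "tau (Suc N) d = 2 * tau N d - tau N (d + 1) - tau N (d - 1)"

lemma tau_minus [simp]: "tau N (- d) = tau N d"
proof (induction N arbitrary: d)
  case (Suc N)
  have "- d + 1 = - (d - 1)" "- d - 1 = - (d + 1)" by auto
  then show ?case by (simp only: tau.simps Suc)
qed auto

lemma tau_eq_0: "int N < \<bar>d\<bar> \<Longrightarrow> tau N d = 0"
  by (induction N arbitrary: d) auto

text \<open>Expanding one factor z - w on each side shifts \<open>i - i'\<close> by 0, 1 and -1,
  which is the recursion of \<open>tau\<close>. Within one degree the Gram matrix is thus a real
  Toeplitz matrix.\<close>

lemma cinner_diag_gen: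
  "cinner (diag_gen N i j) (diag_gen N i' j') =
     (if i + j = i' + j' then of_real (tau N (int i - int i')) else 0)"
proof (induction N arbitrary: i j i' j')
  case 0
  have "cinner (diag_gen 0 i j) (diag_gen 0 i' j') =
      (\<Sum>\<^sub>\<infinity>k\<in>{(i, j)}. if (i', j') = (i, j) then 1 else 0)"
    unfolding cinner_def by (rule infsum_cong_neutral) (auto simp: h2_coeff_monom)
  then show ?case by auto
next
  case (Suc N)
  show ?case
    unfolding diag_gen_Suc cinner_simps Suc.IH by (auto simp: algebra_simps)
qed

text \<open>Polynomial functions of degree less than \<open>n\<close>, characterised by vanishing differences.\<close>

primrec poly_fun :: "nat \<Rightarrow> (int \<Rightarrow> real) \<Rightarrow> bool" where
  "poly_fun 0 f \<longleftrightarrow> (\<forall>x. f x = 0)"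
| "poly_fun (Suc n) f \<longleftrightarrow> poly_fun n (\<lambda>x. f (x + 1) - f x)"

lemma poly_fun_shift: "poly_fun n f \<Longrightarrow> poly_fun n (\<lambda>x. f (x + a))"
proof (induction n arbitrary: f)
  case (Suc n)
  from Suc.IH[of "\<lambda>x. f (x + 1) - f x"] Suc.prems show ?case
    by (simp add: ac_simps)
qed auto

lemma poly_fun_cmult: "poly_fun n f \<Longrightarrow> poly_fun n (\<lambda>x. c * f x)"
proof (induction n arbitrary: f)
  case (Suc n)
  from Suc.IH[of "\<lambda>x. f (x + 1) - f x"] Suc.prems show ?case
    by (simp add: right_diff_distrib)
qed auto

lemma poly_fun_add: "poly_fun n f \<Longrightarrow> poly_fun n g \<Longrightarrow> poly_fun n (\<lambda>x. f x + g x)"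
proof (induction n arbitrary: f g)
  case (Suc n)
  from Suc.IH[of "\<lambda>x. f (x + 1) - f x" "\<lambda>x. g (x + 1) - g x"] Suc.prems show ?case
    by (simp add: algebra_simps)
qed auto

text \<open>Product rule for the forward difference: the difference of f l, with l linear of slope
  \<open>a\<close>, is that of f times l, plus \<open>a * f (x + 1)\<close>.\<close>

lemma poly_fun_mult_linear:
  "poly_fun n f \<Longrightarrow> poly_fun (Suc n) (\<lambda>x. f x * (a * of_int x + b))"
proof (induction n arbitrary: f)
  case (Suc n)
  let ?g = "\<lambda>x. f (x + 1) - f x"
  have "poly_fun (Suc n) (\<lambda>x. ?g x * (a * of_int x + b))"
    by (rule Suc.IH) (use Suc.prems in simp)
  moreover have "poly_fun (Suc n) (\<lambda>x. a * f (x + 1))"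
    using Suc.prems by (intro poly_fun_cmult poly_fun_shift)
  ultimately have "poly_fun (Suc n) (\<lambda>x. ?g x * (a * of_int x + b) + a * f (x + 1))"
    by (rule poly_fun_add)
  then show ?case
    by (subst poly_fun.simps) (simp add: algebra_simps del: poly_fun.simps)
qed auto

lemma poly_fun_prod_linear:
  assumes "finite S" "poly_fun n f"
  shows "poly_fun (n + card S) (\<lambda>x. f x * (\<Prod>l\<in>S. a l * of_int x + b l))"
  using assms
proof (induction S rule: finite_induct)
  case (insert l S)
  from poly_fun_mult_linear[OF insert.IH[OF insert.prems], of "a l" "b l"] insert.hyps
  show ?case by (simp add: mult_ac del: poly_fun.simps)
qed auto

text \<open>Summation by parts: one step of the \<open>tau\<close> recursion is moved onto
  \<open>f\<close> as a negated second difference, which lowers the order by two.\<close>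

lemma tau_convolution_eq_0:
  assumes "poly_fun (2 * N) f" "int N \<le> L"
  shows "(\<Sum>d\<in>{- L..L}. tau N d * f (x + d)) = 0"
  using assms
proof (induction N arbitrary: f L)
  case (Suc N)
  let ?g = "\<lambda>x. 2 * f x - f (x - 1) - f (x + 1)"
  have "poly_fun (2 * N) (\<lambda>x. (f (x + 1 + 1) - f (x + 1)) - (f (x + 1) - f x))"
    using Suc.prems(1) by simp
  from poly_fun_cmult[OF poly_fun_shift[OF this, of "-1"], of "-1"]
  have g: "poly_fun (2 * N) ?g"
    by (simp add: algebra_simps)
  \<comment> \<open>\<open>tau N\<close> vanishes outside \<open>{- L + 1..L - 1}\<close>, so the
    three windows displaced by the shifts can be replaced by one common window.\<close>
  have ext: "(\<Sum>d\<in>{- L - 1..L + 1}. tau N d * u d) = (\<Sum>d\<in>A. tau N d * u d)"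
    if "{- L + 1..L - 1} \<subseteq> A" "A \<subseteq> {- L - 1..L + 1}" for A u
  proof (rule sum.mono_neutral_right)
    show "\<forall>d\<in>{- L - 1..L + 1} - A. tau N d * u d = 0"
    proof
      fix d assume "d \<in> {- L - 1..L + 1} - A"
      then have "d \<notin> {- L + 1..L - 1}" using that by blast
      then have "tau N d = 0" using Suc.prems(2) by (intro tau_eq_0) auto
      then show "tau N d * u d = 0" by simp
    qed
  qed (use that in auto)
  have "(\<Sum>d\<in>{- L..L}. tau (Suc N) d * f (x + d)) =
      (\<Sum>d\<in>{- L..L}. tau N d * (2 * f (x + d)))
      - (\<Sum>d\<in>{- L..L}. tau N (d + 1) * f (x + d)) - (\<Sum>d\<in>{- L..L}. tau N (d - 1) * f (x + d))"
    by (simp add: sum_subtractf[symmetric] algebra_simps)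
  also have "(\<Sum>d\<in>{- L..L}. tau N (d + 1) * f (x + d)) =
      (\<Sum>d\<in>{- L + 1..L + 1}. tau N d * f (x + d - 1))"
    by (rule sum.reindex_bij_witness[of _ "\<lambda>d. d - 1" "\<lambda>d. d + 1"]) auto
  also have "(\<Sum>d\<in>{- L..L}. tau N (d - 1) * f (x + d)) =
      (\<Sum>d\<in>{- L - 1..L - 1}. tau N d * f (x + d + 1))"
    by (rule sum.reindex_bij_witness[of _ "\<lambda>d. d + 1" "\<lambda>d. d - 1"]) (auto simp: algebra_simps)
  also have "(\<Sum>d\<in>{- L..L}. tau N d * (2 * f (x + d)))
      - (\<Sum>d\<in>{- L + 1..L + 1}. tau N d * f (x + d - 1))
      - (\<Sum>d\<in>{- L - 1..L - 1}. tau N d * f (x + d + 1))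
      = (\<Sum>d\<in>{- L - 1..L + 1}. tau N d * ?g (x + d))"
    by (subst (1 2 3) ext[symmetric]) (auto simp: sum_subtractf[symmetric] algebra_simps)
  also have "- L - 1 = - (L + 1)" by simp
  also have "(\<Sum>d\<in>{- (L + 1)..L + 1}. tau N d * ?g (x + d)) = 0"
    by (rule Suc.IH[OF g]) (use Suc.prems(2) in simp)
  finally show ?case .
qed auto

section \<open>Tails of the series of inverse squares\<close>

definition inv_sq_tail :: "nat \<Rightarrow> real" where
  "inv_sq_tail N = (\<Sum>\<^sub>\<infinity>j\<in>{N + 1..}. 1 / (real j)\<^sup>2)"

lemma has_sum_inv_sq_tail: "((\<lambda>m. 1 / (real (N + Suc m))\<^sup>2) has_sum inv_sq_tail N) UNIV"
proof -
  have "summable (\<lambda>m. 1 / (real (m + Suc N))\<^sup>2)"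
    using inverse_power_summable[of 2, where 'a=real]
    by (subst summable_iff_shift) (simp add: inverse_eq_divide power_divide)
  then have "(\<lambda>m. 1 / (real (N + Suc m))\<^sup>2) summable_on UNIV"
    by (intro summable_nonneg_imp_summable_on) (simp_all add: add_ac)
  then have "((\<lambda>m. 1 / (real (N + Suc m))\<^sup>2) has_sum (\<Sum>\<^sub>\<infinity>m. 1 / (real (N + Suc m))\<^sup>2)) UNIV"
    by (rule has_sum_infsum)
  also have "(\<Sum>\<^sub>\<infinity>m. 1 / (real (N + Suc m))\<^sup>2) = inv_sq_tail N"
    unfolding inv_sq_tail_def
    by (rule infsum_reindex_bij_witness[of _ "\<lambda>j. j - Suc N" "\<lambda>m. N + Suc m"]) auto
  finally show ?thesis .
qed

text \<open>The partial sums of the Euler--Maclaurin expansion of the tail alternately under- and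
  overestimate it; each bound follows by comparing termwise with a telescoping series.\<close>

definition em_sum :: "real \<Rightarrow> real" where
  "em_sum x = 1 / x - 1 / (2 * x ^ 2) + 1 / (6 * x ^ 3) - 1 / (30 * x ^ 5)"

text \<open>Over a common denominator the gap has a numerator with positive coefficients only, so
  its sign is visible.\<close>

lemma em_sum_lower:
  assumes "x > 0"
  shows "em_sum x - em_sum (x + 1) \<le> 1 / (x + 1)\<^sup>2"
proof -
  have "1 / (x + 1)\<^sup>2 - (em_sum x - em_sum (x + 1)) =
      (5 * x ^ 2 + 5 * x + 1) / (30 * x ^ 5 * (x + 1) ^ 5)"
    using assms unfolding em_sum_def by (simp add: divide_simps) algebra
  moreover have "\<dots> \<ge> 0" using assms by simp
  ultimately show ?thesis by linarith
qed

text \<open>The added term is the next one of the expansion, with Bernoulli number B_6 = 1/42; it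
  reverses the sign of the gap.\<close>

lemma em_sum_upper:
  assumes "x > 0"
  shows "1 / (x + 1)\<^sup>2 \<le> (em_sum x + 1 / (42 * x ^ 7)) - (em_sum (x + 1) + 1 / (42 * (x + 1) ^ 7))"
proof -
  have "(em_sum x + 1 / (42 * x ^ 7)) - (em_sum (x + 1) + 1 / (42 * (x + 1) ^ 7)) - 1 / (x + 1)\<^sup>2 =
      (63 * x ^ 4 + 126 * x ^ 3 + 98 * x ^ 2 + 35 * x + 5) / (210 * x ^ 7 * (x + 1) ^ 7)"
    using assms unfolding em_sum_def by (simp add: divide_simps) algebra
  moreover have "\<dots> \<ge> 0" using assms by simp
  ultimately show ?thesis by linarith
qed

lemma inv_sq_tail_bounds:
  assumes "N \<ge> 1"
  shows "em_sum (real N) \<le> inv_sq_tail N"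
    and "inv_sq_tail N \<le> em_sum (real N) + 1 / (42 * real N ^ 7)"
proof -
  have lim: "(\<lambda>n. em_sum (real (N + n))) \<longlonglongrightarrow> 0"
    "(\<lambda>n. em_sum (real (N + n)) + 1 / (42 * real (N + n) ^ 7)) \<longlonglongrightarrow> 0"
    unfolding em_sum_def by real_asymp+
  have sums: "(\<lambda>n. 1 / (real (N + Suc n))\<^sup>2) sums inv_sq_tail N"
    by (rule has_sum_imp_sums[OF has_sum_inv_sq_tail])
  have "(\<lambda>n. em_sum (real (N + n)) - em_sum (real (N + Suc n))) sums (em_sum (real (N + 0)) - 0)"
    by (rule telescope_sums'[OF lim(1)])
  moreover have "em_sum (real (N + n)) - em_sum (real (N + Suc n)) \<le> 1 / (real (N + Suc n))\<^sup>2" for n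
    using em_sum_lower[of "real (N + n)"] assms by (simp add: add_ac)
  ultimately show "em_sum (real N) \<le> inv_sq_tail N"
    using sums_le[OF _ _ sums] by fastforce
  have "(\<lambda>n. (em_sum (real (N + n)) + 1 / (42 * real (N + n) ^ 7)) -
      (em_sum (real (N + Suc n)) + 1 / (42 * real (N + Suc n) ^ 7)))
      sums (em_sum (real (N + 0)) + 1 / (42 * real (N + 0) ^ 7) - 0)"
    by (rule telescope_sums'[OF lim(2)])
  moreover have "1 / (real (N + Suc n))\<^sup>2 \<le> (em_sum (real (N + n)) + 1 / (42 * real (N + n) ^ 7)) -
      (em_sum (real (N + Suc n)) + 1 / (42 * real (N + Suc n) ^ 7))" for n
    using em_sum_upper[of "real (N + n)"] assms by (simp add: add_ac)
  ultimately show "inv_sq_tail N \<le> em_sum (real N) + 1 / (42 * real N ^ 7)"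
    using sums_le[OF _ sums] by fastforce
qed

text \<open>Multiplied by \<open>2 * (real N)^2\<close>, \<open>em_sum\<close> yields exactly the
  stated terms and a -1 that cancels the leading 1. The error is at most 2 N^2 / (42 N^7), hence the
  constant 1/21.\<close>

lemma inv_sq_tail_asymp:
  "(\<lambda>N. 1 + 2 * (real N)\<^sup>2 * inv_sq_tail N - (2 * real N + 1 / (3 * real N) - 1 / (15 * real N ^ 3)))
    \<in> O(\<lambda>N. 1 / real N ^ 5)"
proof (rule bigoI[of _ "1/21"], rule eventually_sequentiallyI[of 1])
  fix N :: nat assume N: "1 \<le> N"
  define d where "d = inv_sq_tail N - em_sum (real N)"
  have d: "0 \<le> d" "d \<le> 1 / (42 * real N ^ 7)"
    using inv_sq_tail_bounds[OF N] by (auto simp: d_def)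
  have "2 * (real N)\<^sup>2 * em_sum (real N) = 2 * real N - 1 + 1 / (3 * real N) - 1 / (15 * real N ^ 3)"
    using N by (simp add: em_sum_def field_simps power2_eq_square eval_nat_numeral)
  then have "1 + 2 * (real N)\<^sup>2 * inv_sq_tail N - (2 * real N + 1 / (3 * real N) - 1 / (15 * real N ^ 3)) =
      2 * (real N)\<^sup>2 * d"
    by (simp add: d_def right_diff_distrib)
  moreover have "2 * (real N)\<^sup>2 * d \<le> 2 * (real N)\<^sup>2 * (1 / (42 * real N ^ 7))"
    using d by (intro mult_left_mono) auto
  moreover have "2 * (real N)\<^sup>2 * (1 / (42 * real N ^ 7)) = 1/21 * (1 / real N ^ 5)"
    using N by (simp add: field_simps eval_nat_numeral)
  ultimately show "norm (1 + 2 * (real N)\<^sup>2 * inv_sq_tail N -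
      (2 * real N + 1 / (3 * real N) - 1 / (15 * real N ^ 3))) \<le> 1/21 * norm (1 / real N ^ 5)"
    using d(1) by simp
qed

text \<open>A crude bound, sufficient for the supremum to be infinite.\<close>

lemma inv_sq_tail_ge: "1 \<le> N \<Longrightarrow> real N \<le> 1 + 2 * (real N)\<^sup>2 * inv_sq_tail N"
proof -
  assume N: "1 \<le> N"
  have "2 * (real N)\<^sup>2 * em_sum (real N) = 2 * real N - 1 + (1 / (3 * real N) - 1 / (15 * real N ^ 3))"
    using N by (simp add: em_sum_def field_simps power2_eq_square eval_nat_numeral)
  moreover have "1 / (15 * real N ^ 3) \<le> 1 / (3 * real N)"
  proof (rule frac_le)
    have "real N ^ 1 \<le> real N ^ 3" using N by (intro power_increasing) auto
    then show "3 * real N \<le> 15 * real N ^ 3" unfolding power_one_right by linarith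
  qed (use N in auto)
  moreover have "2 * (real N)\<^sup>2 * em_sum (real N) \<le> 2 * (real N)\<^sup>2 * inv_sq_tail N"
    using inv_sq_tail_bounds(1)[OF N] by (intro mult_left_mono) auto
  ultimately show ?thesis using N by linarith
qed

section \<open>Orthogonal basis of the diagonal submodule\<close>

lemma h2_poly_sum: "h2_poly (\<Sum>i\<in>I. f i) = (\<Sum>i\<in>I. h2_poly (f i))"
  by (induction I rule: infinite_finite_induct) (simp_all add: h2_poly_add)

locale diag_module =
  fixes N :: nat
  assumes N_pos: "1 \<le> N"
begin

abbreviation "M \<equiv> diag_submodule N"
abbreviation "P \<equiv> diag_gen N"

text \<open>The multiples of (z - w)^N already form a subspace, and splitting the cofactor into
  monomials shows that it is the span of the generators; \<open>closure_span_induct\<close> becomes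
  available for \<open>M\<close>.\<close>

lemma diag_submodule_eq: "M = closure (hardy2.span (range (\<lambda>(i, j). P i j)))"
proof -
  let ?p = "(var_z - var_w) ^ N"
  let ?R = "range (\<lambda>q. h2_poly (?p * q))"
  have lin: "h2_poly (?p * ([:[:c:]:] * q)) = c *\<^sub>C h2_poly (?p * q)" for c q
    by (subst mult.left_commute) (rule h2_poly_const_mult)
  have "hardy2.subspace ?R"
  proof (rule hardy2.subspaceI)
    show "0 \<in> ?R" by (rule range_eqI[of _ _ 0]) simp
    show "f + g \<in> ?R" if "f \<in> ?R" "g \<in> ?R" for f g
      using that by (auto simp: h2_poly_add[symmetric] distrib_left[symmetric])
    show "c *\<^sub>C f \<in> ?R" if "f \<in> ?R" for c f
    proof -
      obtain q where "f = h2_poly (?p * q)" using \<open>f \<in> ?R\<close> by blast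
      then have "c *\<^sub>C f = h2_poly (?p * ([:[:c:]:] * q))" by (simp only: lin)
      then show ?thesis by blast
    qed
  qed
  moreover have "range (\<lambda>(i, j). P i j) \<subseteq> ?R"
    by (auto simp: diag_gen_def)
  ultimately have "hardy2.span (range (\<lambda>(i, j). P i j)) \<subseteq> ?R"
    by (rule hardy2.span_minimal[rotated])
  moreover have "?R \<subseteq> hardy2.span (range (\<lambda>(i, j). P i j))" (is "_ \<subseteq> ?S")
  proof safe
    fix q :: "complex poly poly"
    have monom: "h2_poly (?p * monom (monom c i) j) \<in> ?S" for c i j
    proof -
      have "monom (monom c i) j = [:[:c:]:] * monom (monom 1 i) j"
        by (intro poly_eqI) (auto simp: smult_monom)
      then have "h2_poly (?p * monom (monom c i) j) = c *\<^sub>C P i j"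
        by (simp only: lin diag_gen_def)
      moreover have "P i j \<in> ?S"
        by (rule hardy2.span_base, rule range_eqI[of _ _ "(i, j)"]) simp
      ultimately show ?thesis by (simp only: hardy2.span_scale)
    qed
    have "q = (\<Sum>j\<le>degree q. \<Sum>i\<le>degree (coeff q j). monom (monom (coeff (coeff q j) i) i) j)"
      by (simp add: monom_sum[symmetric] poly_as_sum_of_monoms)
    then have "h2_poly (?p * q) = (\<Sum>j\<le>degree q. \<Sum>i\<le>degree (coeff q j).
        h2_poly (?p * monom (monom (coeff (coeff q j) i) i) j))"
      by (metis (no_types, lifting) h2_poly_sum sum.cong sum_distrib_left)
    then show "h2_poly (?p * q) \<in> ?S"
      by (simp add: hardy2.span_sum monom)
  qed
  ultimately have "?R = ?S" by (rule subset_antisym[rotated])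
  then show ?thesis by (simp add: diag_submodule_def poly_submodule_def)
qed

lemma subspace_M: "hardy2.subspace M"
  unfolding diag_submodule_eq by (intro subspace_closure hardy2.subspace_span)

lemmas M_add = hardy2.subspace_add[OF subspace_M]
  and M_diff = hardy2.subspace_diff[OF subspace_M]
  and M_scale = hardy2.subspace_scale[OF subspace_M]
  and M_0 = hardy2.subspace_0[OF subspace_M]

lemma P_in_M: "P i j \<in> M"
  unfolding diag_submodule_eq by (intro subsetD[OF closure_subset] hardy2.span_base) auto

lemma M_induct:
  assumes "f \<in> M" "closed (Collect Q)" "hardy2.subspace (Collect Q)" "\<And>i j. Q (P i j)"
  shows "Q f"
  using assms(1) unfolding diag_submodule_eq
  by (rule closure_span_induct) (use assms in auto)

lemma closed_M: "closed M"
  by (simp add: diag_submodule_eq)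

lemma mult_z_in_M: "f \<in> M \<Longrightarrow> mult_z f \<in> M"
proof (erule M_induct)
  show "closed {f. mult_z f \<in> M}"
    using closed_vimage[OF closed_M, of mult_z] linear_continuous_on[OF bounded_linear_mult_z]
    by (simp add: vimage_def)
  show "hardy2.subspace {f. mult_z f \<in> M}"
    by (rule hardy2.subspaceI) (auto simp: mult_z_add mult_z_scaleC M_0 M_add M_scale)
qed (simp add: mult_z_diag_gen P_in_M)

lemma mult_w_in_M: "f \<in> M \<Longrightarrow> mult_w f \<in> M"
proof (erule M_induct)
  show "closed {f. mult_w f \<in> M}"
    using closed_vimage[OF closed_M, of mult_w] linear_continuous_on[OF bounded_linear_mult_w]
    by (simp add: vimage_def)
  show "hardy2.subspace {f. mult_w f \<in> M}"
    by (rule hardy2.subspaceI) (auto simp: mult_w_add mult_w_scaleC M_0 M_add M_scale)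
qed (simp add: mult_w_diag_gen P_in_M)

section \<open>Homogeneous elements and the vectors U and V\<close>

text \<open>Real coefficients suffice because the Gram matrix is real. Values of \<open>c\<close>
  beyond \<open>m\<close> are ignored, so one function can serve in degrees \<open>m\<close> and
  \<open>Suc m\<close>.\<close>

definition comb :: "nat \<Rightarrow> (nat \<Rightarrow> real) \<Rightarrow> hardy2" where
  "comb m c = (\<Sum>k\<le>m. of_real (c k) *\<^sub>C P k (m - k))"

lemma comb_in_M: "comb m c \<in> M"
  unfolding comb_def
  by (intro hardy2.subspace_sum[OF subspace_M] M_scale P_in_M)

lemma cinner_P_comb:
  "cinner (P i j) (comb m c) =
     (if i + j = m then of_real (\<Sum>k\<le>m. tau N (int i - int k) * c k) else 0)"
  by (simp add: comb_def cinner_sum_right cinner_simps cinner_diag_gen mult.commute)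

lemma cinner_comb_neq: "m \<noteq> n \<Longrightarrow> cinner (comb m c) (comb n d) = 0"
  by (simp add: comb_def[of m] cinner_sum_left cinner_simps cinner_P_comb)

lemma comb_diff: "comb m c - of_real a *\<^sub>C comb m d = comb m (\<lambda>k. c k - a * d k)"
  by (simp add: comb_def hardy2.scale_sum_right sum_subtractf[symmetric]
      hardy2.scale_left_diff_distrib)

lemma scaleC_comb: "of_real a *\<^sub>C comb m c = comb m (\<lambda>k. a * c k)"
  by (simp add: comb_def hardy2.scale_sum_right)

lemma comb_cong: "(\<And>k. k \<le> m \<Longrightarrow> c k = d k) \<Longrightarrow> comb m c = comb m d"
  by (simp add: comb_def)

text \<open>Only the term \<open>k = Suc m\<close> lacks a factor w. Dually, only
  \<open>k = 0\<close> lacks a factor z.\<close>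

lemma comb_eq_mult_w: "c (Suc m) = 0 \<Longrightarrow> comb (Suc m) c = mult_w (comb m c)"
  by (simp add: comb_def mult_w_sum mult_w_scaleC mult_w_diag_gen Suc_diff_le)

lemma comb_eq_mult_z: "c 0 = 0 \<Longrightarrow> comb (Suc m) c = mult_z (comb m (\<lambda>k. c (Suc k)))"
  unfolding comb_def sum.atMost_Suc_shift
  by (simp add: mult_z_sum mult_z_scaleC mult_z_diag_gen)

lemma comb_in_mult_w: "c m = 0 \<Longrightarrow> \<exists>f\<in>M. comb m c = mult_w f"
  by (cases m) (auto simp: comb_eq_mult_w comb_in_M comb_def[of 0] intro: bexI[of _ 0] M_0)

lemma comb_in_mult_z: "c 0 = 0 \<Longrightarrow> \<exists>f\<in>M. comb m c = mult_z f"
  by (cases m) (auto simp: comb_eq_mult_z comb_in_M comb_def[of 0] intro: bexI[of _ 0] M_0)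

text \<open>Up to a constant factor, \<open>wgt m k\<close> is the \<open>k\<close>-th coefficient of the reversed orthogonal
  polynomial.  As a polynomial in \<open>k\<close> it has degree \<open>2 N - 1\<close>, so it is annihilated by the differences
  of order \<open>2 N\<close> that \<open>tau N\<close> encodes, and it vanishes at the \<open>N - 1\<close> integers before and the \<open>N\<close> integers
  after \<open>{0..m}\<close>, so truncation to \<open>{0..m}\<close> does not disturb this.\<close>

definition wgt :: "nat \<Rightarrow> int \<Rightarrow> real" where
  "wgt m x = (\<Prod>l\<in>{1..<N}. of_int x + of_nat l) * (\<Prod>l\<in>{1..N}. of_nat m + of_nat l - of_int x)"

text \<open>Enters as the ratio of the two end coefficients in \<open>wgt_m\<close> and turns out to
  be both the cosine and the modulus of the eigenvalues. It equals 1 at \<open>m = 0\<close>, where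
  U and V coincide.\<close>

definition lam :: "nat \<Rightarrow> real" where
  "lam m = real N / real (N + m)"

lemma prod_upto_N: "(\<Prod>l\<in>{1..N}. f l) = (\<Prod>l\<in>{1..<N}. f l) * f N"
  using N_pos by (cases N) (auto simp: atLeastLessThanSuc_atLeastAtMost prod.nat_ivl_Suc')

lemma prod_upto_N_shift: "(\<Prod>l\<in>{1..N}. f l) = f 1 * (\<Prod>l\<in>{1..<N}. f (Suc l))"
proof -
  have "(\<Prod>l\<in>{1..N}. f l) = f 1 * (\<Prod>l\<in>{Suc 1..<Suc N}. f l)"
    using N_pos by (simp add: atLeastLessThanSuc_atLeastAtMost prod.atLeast_Suc_atMost)
  also have "(\<Prod>l\<in>{Suc 1..<Suc N}. f l) = (\<Prod>l\<in>{1..<N}. f (Suc l))"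
    by (rule prod.shift_bounds_Suc_ivl)
  finally show ?thesis .
qed

lemma poly_fun_wgt: "poly_fun (2 * N) (wgt m)"
proof -
  have "poly_fun 1 (\<lambda>x. 1)" by simp
  from poly_fun_prod_linear[OF _ this, of "{1..<N}" "\<lambda>_. 1" "\<lambda>l. of_nat l"]
  have "poly_fun N (\<lambda>x. \<Prod>l\<in>{1..<N}. of_int x + of_nat l)"
    using N_pos by simp
  from poly_fun_prod_linear[OF _ this, of "{1..N}" "\<lambda>_. -1" "\<lambda>l. of_nat m + of_nat l"]
  show ?thesis by (simp add: wgt_def[abs_def] mult_2)
qed

lemma wgt_eq_0: "- int N < x \<Longrightarrow> x < 0 \<or> int m < x \<Longrightarrow> x \<le> int (m + N) \<Longrightarrow> wgt m x = 0"
proof (elim disjE)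
  assume "- int N < x" "x < 0"
  then have "nat (- x) \<in> {1..<N}" "of_int x + real (nat (- x)) = 0" by auto
  then have "(\<Prod>l\<in>{1..<N}. of_int x + real l) = 0"
    by (intro prod_zero) auto
  then show ?thesis by (simp add: wgt_def)
next
  assume "int m < x" "x \<le> int (m + N)"
  then have "nat (x - int m) \<in> {1..N}" "real m + real (nat (x - int m)) - of_int x = 0" by auto
  then have "(\<Prod>l\<in>{1..N}. real m + real l - of_int x) = 0"
    by (intro prod_zero) blast+
  then show ?thesis by (simp add: wgt_def)
qed

text \<open>The truncated sum extends to a full convolution: for i in 1..m, the support of
  \<open>tau N\<close> reaches only points between 1 - N and m + N, and those outside 0..m are roots
  of \<open>wgt m\<close>. For i = 0 the point -N would be reached, which is not a root.\<close>

lemma tau_wgt: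
  assumes "1 \<le> i" "i \<le> m"
  shows "(\<Sum>k\<le>m. tau N (int i - int k) * wgt m (int k)) = 0"
proof -
  let ?L = "int (N + m)"
  have "(\<Sum>k\<le>m. tau N (int i - int k) * wgt m (int k)) =
      (\<Sum>d\<in>(\<lambda>k. int k - int i) ` {..m}. tau N d * wgt m (int i + d))"
  proof -
    have "tau N (int k - int i) = tau N (int i - int k)" for k
      using tau_minus[of N "int i - int k"] by simp
    then show ?thesis by (subst sum.reindex) (auto simp: inj_on_def)
  qed
  also have "\<dots> = (\<Sum>d\<in>{- ?L..?L}. tau N d * wgt m (int i + d))"
  proof (rule sum.mono_neutral_left)
    show "\<forall>d\<in>{- ?L..?L} - (\<lambda>k. int k - int i) ` {..m}. tau N d * wgt m (int i + d) = 0"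
    proof
      fix d assume d: "d \<in> {- ?L..?L} - (\<lambda>k. int k - int i) ` {..m}"
      have "int i + d < 0 \<or> int m < int i + d"
      proof (rule ccontr)
        assume "\<not> ?thesis"
        then have "d = int (nat (int i + d)) - int i" "nat (int i + d) \<in> {..m}" by auto
        then show False using d by blast
      qed
      then show "tau N d * wgt m (int i + d) = 0"
        using assms wgt_eq_0[of "int i + d" m] tau_eq_0[of N d] by fastforce
    qed
  qed (use assms in auto)
  also have "\<dots> = 0"
    by (rule tau_convolution_eq_0[OF poly_fun_wgt]) simp
  finally show ?thesis .
qed

lemma wgt_0_pos: "wgt m 0 > 0"
  by (auto simp: wgt_def intro!: mult_pos_pos prod_pos)

text \<open>Passing from 0 to m exchanges the ranges of the two products except for their last
  factors N and N + m.\<close>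

lemma wgt_m: "wgt m (int m) = lam m * wgt m 0"
  unfolding wgt_def prod_upto_N lam_def using N_pos by (simp add: field_simps)

text \<open>The Szego recursion, solved for the lower degree; the prefactor is
  \<open>1 / (1 + lam (Suc m))\<close>. All three weights share the factors \<open>A\<close> and
  \<open>D\<close>, and what remains is an identity between linear functions of
  \<open>x\<close>.\<close>

lemma wgt_Suc:
  "wgt m x = (real (m + 1 + N) / real (m + 1 + 2 * N)) *
     (wgt (Suc m) x - lam (Suc m) * wgt (Suc m) (int (Suc m) - x))"
proof -
  define A D where "A = (\<Prod>l\<in>{1..<N}. of_int x + real l)"
    and "D = (\<Prod>l\<in>{1..<N}. real (Suc m) + real l - of_int x)"
  have 1: "wgt m x = A * ((real (Suc m) - of_int x) * D)"
    unfolding wgt_def prod_upto_N_shift A_def D_def by (simp add: algebra_simps)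
  have 2: "wgt (Suc m) x = A * (D * (real (Suc m) + real N - of_int x))"
    unfolding wgt_def prod_upto_N A_def D_def by (simp add: algebra_simps)
  have 3: "wgt (Suc m) (int (Suc m) - x) = D * (A * (of_int x + real N))"
    unfolding wgt_def prod_upto_N A_def D_def by (simp add: algebra_simps)
  have lam: "lam (Suc m) = real N / real (m + 1 + N)"
    by (simp add: lam_def add_ac)
  have solve: "A * (r * D) = a / b * (A * (D * p) - n / a * (D * (A * q)))"
    if "a * p - n * q = b * r" "a \<noteq> 0" "b \<noteq> 0" for a b p n q r :: real
  proof -
    have "a / b * (A * (D * p) - n / a * (D * (A * q))) = A * D * (a * p - n * q) / b"
      using that(2,3) by (simp add: field_simps)
    then show ?thesis using that by simp
  qed
  show ?thesis
    unfolding 1 2 3 lam by (rule solve) (simp_all add: algebra_simps)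
qed

definition vecU :: "nat \<Rightarrow> hardy2" where
  "vecU m = comb m (\<lambda>k. wgt m (int k))"

definition vecV :: "nat \<Rightarrow> hardy2" where
  "vecV m = comb m (\<lambda>k. wgt m (int m - int k))"

lemma vecU_in_M: "vecU m \<in> M" and vecV_in_M: "vecV m \<in> M"
  by (simp_all add: vecU_def vecV_def comb_in_M)

text \<open>Multiplication by z moves row \<open>i\<close> of the Gram matrix to row
  \<open>Suc i\<close>, so row 0, the only one not covered by \<open>tau_wgt\<close>, never
  occurs.\<close>

lemma cinner_mult_z_vecU: "f \<in> M \<Longrightarrow> cinner (mult_z f) (vecU m) = 0"
proof (erule M_induct)
  show "closed {f. cinner (mult_z f) (vecU m) = 0}"
    by (intro closed_bounded_linear_eq bounded_linear_zero
        bounded_linear_compose[OF bounded_linear_cinner_left bounded_linear_mult_z])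
  show "hardy2.subspace {f. cinner (mult_z f) (vecU m) = 0}"
    by (rule hardy2.subspaceI) (auto simp: mult_z_add mult_z_scaleC cinner_simps)
  show "cinner (mult_z (P i j)) (vecU m) = 0" for i j
    using tau_wgt[of "Suc i" m] by (auto simp: mult_z_diag_gen vecU_def cinner_P_comb)
qed

lemma cinner_mult_w_vecV: "f \<in> M \<Longrightarrow> cinner (mult_w f) (vecV m) = 0"
proof (erule M_induct)
  show "closed {f. cinner (mult_w f) (vecV m) = 0}"
    by (intro closed_bounded_linear_eq bounded_linear_zero
        bounded_linear_compose[OF bounded_linear_cinner_left bounded_linear_mult_w])
  show "hardy2.subspace {f. cinner (mult_w f) (vecV m) = 0}"
    by (rule hardy2.subspaceI) (auto simp: mult_w_add mult_w_scaleC cinner_simps)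
  show "cinner (mult_w (P i j)) (vecV m) = 0" for i j
  proof (cases "i + Suc j = m")
    case True
    \<comment> \<open>The reflection of k to m - k exchanges the roles of z and w and reduces the
      claim to \<open>tau_wgt\<close> in row \<open>Suc j\<close>.\<close>
    have "(\<Sum>k\<le>m. tau N (int i - int k) * wgt m (int m - int k)) =
        (\<Sum>k\<le>m. tau N (int (Suc j) - int k) * wgt m (int k))"
    proof (rule sum.reindex_bij_witness[of _ "\<lambda>k. m - k" "\<lambda>k. m - k"])
      fix k assume k: "k \<in> {..m}"
      have "int (Suc j) - int (m - k) = - (int i - int k)"
        using True k by (simp add: of_nat_diff)
      then show "tau N (int (Suc j) - int (m - k)) * wgt m (int (m - k)) =
          tau N (int i - int k) * wgt m (int m - int k)"
        using k by (simp only: tau_minus) (simp add: of_nat_diff)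
    qed auto
    then show ?thesis
      using True tau_wgt[of "Suc j" m] by (auto simp: mult_w_diag_gen vecV_def cinner_P_comb)
  qed (auto simp: mult_w_diag_gen vecV_def cinner_P_comb)
qed

text \<open>By \<open>wgt_m\<close> the coefficient at k = m cancels, so the difference is divisible
  by w within \<open>M\<close>. The decomposition is orthogonal because V is orthogonal to w
  M.\<close>

lemma vecU_eq: "\<exists>f\<in>M. vecU m = of_real (lam m) *\<^sub>C vecV m + mult_w f"
proof -
  have "\<exists>f\<in>M. vecU m - of_real (lam m) *\<^sub>C vecV m = mult_w f"
    unfolding vecU_def vecV_def comb_diff by (rule comb_in_mult_w) (simp add: wgt_m)
  then show ?thesis by (simp add: diff_eq_eq add.commute)
qed

lemma vecV_eq: "\<exists>f\<in>M. vecV m = of_real (lam m) *\<^sub>C vecU m + mult_z f"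
proof -
  have "\<exists>f\<in>M. vecV m - of_real (lam m) *\<^sub>C vecU m = mult_z f"
    unfolding vecU_def vecV_def comb_diff by (rule comb_in_mult_z) (simp add: wgt_m)
  then show ?thesis by (simp add: diff_eq_eq add.commute)
qed

lemma lam_pos: "0 < lam m" and lam_le_1: "lam m \<le> 1" and lam_less_1: "0 < m \<Longrightarrow> lam m < 1"
  and lam_0 [simp]: "lam 0 = 1"
  using N_pos by (auto simp: lam_def)

lemma cinner_vecU_vecV: "cinner (vecU m) (vecV m) = of_real (lam m * (norm (vecV m))\<^sup>2)"
proof -
  obtain f where "f \<in> M" "vecU m = of_real (lam m) *\<^sub>C vecV m + mult_w f"
    using vecU_eq by blast
  then show ?thesis
    by (simp add: cinner_simps cinner_mult_w_vecV cinner_self)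
qed

text \<open>The same inner product is computed from \<open>vecU_eq\<close> and from
  \<open>vecV_eq\<close>; cancelling \<open>lam m > 0\<close> compares the norms.\<close>

lemma norm_vecV: "norm (vecV m) = norm (vecU m)"
proof -
  obtain f where "f \<in> M" "vecV m = of_real (lam m) *\<^sub>C vecU m + mult_z f"
    using vecV_eq by blast
  then have "cinner (vecV m) (vecU m) = of_real (lam m * (norm (vecU m))\<^sup>2)"
    by (simp add: cinner_simps cinner_mult_z_vecU cinner_self)
  then have "complex_of_real (lam m * (norm (vecV m))\<^sup>2) = of_real (lam m * (norm (vecU m))\<^sup>2)"
    using cinner_vecU_vecV[of m] cinner_commute[of "vecU m" "vecV m"]
    by (simp only: complex_cnj_complex_of_real)
  then show ?thesis
    using lam_pos[of m] unfolding of_real_eq_iff by (simp add: power2_eq_iff_nonneg)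
qed

lemma cinner_vecV_vecU: "cinner (vecV m) (vecU m) = of_real (lam m * (norm (vecU m))\<^sup>2)"
  using cinner_commute[of "vecV m" "vecU m"] cinner_vecU_vecV[of m] by (simp add: norm_vecV)

text \<open>At the point (0, 1/2) only the term k = 0 survives, with the positive weight
  \<open>wgt m 0\<close>.\<close>

lemma vecU_nonzero: "vecU m \<noteq> 0"
proof
  assume "vecU m = 0"
  have sum: "h2_fun (\<Sum>k\<in>K. f k) x = (\<Sum>k\<in>K. h2_fun (f k) x)" for f :: "nat \<Rightarrow> hardy2" and K x
    by (induction K rule: infinite_finite_induct) (simp_all add: zero_hardy2.rep_eq plus_hardy2.rep_eq)
  have "h2_fun (P k j) (0, 1/2) = (- 1/2) ^ N * 0 ^ k * (1/2) ^ j" for k j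
    by (simp add: diag_gen_def h2_poly.rep_eq bidisc_def eval2_def var_z_def var_w_def poly_monom)
  then have "h2_fun (vecU m) (0, 1/2) = (\<Sum>k\<le>m. if k = 0 then of_real (wgt m 0) * ((- 1/2) ^ N * (1/2) ^ m) else 0)"
    unfolding vecU_def comb_def sum scaleC.rep_eq by (intro sum.cong) auto
  then show False
    using \<open>vecU m = 0\<close> wgt_0_pos[of m] by (simp add: zero_hardy2.rep_eq)
qed

text \<open>As \<open>wgt m\<close> vanishes at m + 1, its values also describe w U_m in degree m +
  1, and \<open>wgt_Suc\<close> applies there.\<close>

lemma mult_w_vecU:
  "mult_w (vecU m) = of_real (real (m + 1 + N) / real (m + 1 + 2 * N)) *\<^sub>C
     (vecU (Suc m) - of_real (lam (Suc m)) *\<^sub>C vecV (Suc m))"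
proof -
  have "mult_w (vecU m) = comb (Suc m) (\<lambda>k. wgt m (int k))"
    unfolding vecU_def using N_pos by (subst comb_eq_mult_w) (auto intro!: wgt_eq_0)
  also have "\<dots> = comb (Suc m) (\<lambda>k. (real (m + 1 + N) / real (m + 1 + 2 * N)) *
      (wgt (Suc m) (int k) - lam (Suc m) * wgt (Suc m) (int (Suc m) - int k)))"
    by (intro comb_cong wgt_Suc)
  finally show ?thesis
    unfolding vecU_def vecV_def comb_diff unfolding scaleC_comb .
qed

section \<open>The orthonormal eigenbasis\<close>

definition mult_zw :: "nat \<Rightarrow> hardy2 \<Rightarrow> hardy2" where
  "mult_zw k = ((\<lambda>f. mult_z (mult_w f)) ^^ k)"

lemma mult_zw_0 [simp]: "mult_zw 0 f = f"
  and mult_zw_Suc: "mult_zw (Suc k) f = mult_z (mult_w (mult_zw k f))"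
  by (simp_all add: mult_zw_def)

lemma mult_zw_add: "mult_zw (k + l) f = mult_zw k (mult_zw l f)"
  by (simp add: mult_zw_def funpow_add)

lemma cinner_mult_zw [simp]: "cinner (mult_zw k f) (mult_zw k g) = cinner f g"
  by (induction k) (simp_all add: mult_zw_Suc)

lemma mult_zw_in_M: "f \<in> M \<Longrightarrow> mult_zw k f \<in> M"
  by (induction k) (simp_all add: mult_zw_Suc mult_z_in_M mult_w_in_M)

definition vecE :: "real \<Rightarrow> nat \<Rightarrow> hardy2" where
  "vecE s m = vecU m + of_real s *\<^sub>C vecV m"

text \<open>The entries are the power of zw, the degree and the sign. At degree 0 the sign -1 is
  left out because \<open>vecE (-1) 0\<close> is zero.\<close>

definition idx :: "(nat \<times> nat \<times> real) set" where
  "idx = {(k, m, s). (s = 1 \<or> s = -1) \<and> (m = 0 \<longrightarrow> s = 1)}"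

definition basis_vec :: "nat \<times> nat \<times> real \<Rightarrow> hardy2" where
  "basis_vec = (\<lambda>(k, m, s). of_real (1 / norm (vecE s m)) *\<^sub>C mult_zw k (vecE s m))"

lemma vecE_in_M: "vecE s m \<in> M"
  by (simp add: vecE_def M_add M_scale vecU_in_M vecV_in_M)

lemma basis_vec_in_M: "basis_vec a \<in> M"
  by (auto simp: basis_vec_def split_beta intro!: M_scale mult_zw_in_M vecE_in_M)

lemma cinner_vecE_neq: "m \<noteq> n \<Longrightarrow> cinner (vecE s m) (vecE t n) = 0"
  by (simp add: vecE_def vecU_def vecV_def cinner_simps cinner_comb_neq)

lemma cinner_vecE:
  assumes "s = 1 \<or> s = -1" "t = 1 \<or> t = -1"
  shows "cinner (vecE s m) (vecE t m) =
    (if s = t then of_real (2 * (1 + s * lam m) * (norm (vecU m))\<^sup>2) else 0)"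
proof -
  note UV = cinner_vecU_vecV[of m, unfolded norm_vecV] and VU = cinner_vecV_vecU[of m]
  show ?thesis
    using assms unfolding vecE_def cinner_simps UV VU cinner_self norm_vecV
    by (auto simp: algebra_simps)
qed

lemma norm_vecE: "s = 1 \<or> s = -1 \<Longrightarrow> (norm (vecE s m))\<^sup>2 = 2 * (1 + s * lam m) * (norm (vecU m))\<^sup>2"
  using cinner_vecE[of s s m] unfolding cinner_self by (simp only: of_real_eq_iff simp_thms if_True)

lemma idx_pos: "(k, m, s) \<in> idx \<Longrightarrow> 0 < 1 + s * lam m"
  using lam_pos[of m] lam_less_1[of m] by (auto simp: idx_def)

lemma norm_vecE_pos: "(k, m, s) \<in> idx \<Longrightarrow> 0 < norm (vecE s m)"
  using norm_vecE[of s m] idx_pos[of k m s] vecU_nonzero[of m]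
  by (auto simp: idx_def)

text \<open>A factor zw puts the vector both in z M, orthogonal to U, and in w M, orthogonal to
  V.\<close>

lemma cinner_vecE_mult_zw:
  assumes "f \<in> M" "0 < l"
  shows "cinner (mult_zw l f) (vecE s m) = 0"
proof -
  obtain l' where l: "l = Suc l'" using assms(2) by (cases l) auto
  show ?thesis
    unfolding l mult_zw_Suc vecE_def cinner_simps
    by (subst (2) mult_z_mult_w)
      (simp add: cinner_mult_z_vecU cinner_mult_w_vecV mult_w_in_M mult_z_in_M mult_zw_in_M assms)
qed

text \<open>The smaller of the two powers of zw is an isometry and can be stripped from both
  sides.\<close>

lemma cinner_basis_vec:
  assumes "a \<in> idx" "b \<in> idx"
  shows "cinner (basis_vec a) (basis_vec b) = (if a = b then 1 else 0)"
proof -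
  obtain k m s where a: "a = (k, m, s)" by (cases a)
  obtain l n t where b: "b = (l, n, t)" by (cases b)
  have "cinner (mult_zw k (vecE s m)) (mult_zw l (vecE t n)) =
      (if a = b then of_real ((norm (vecE s m))\<^sup>2) else 0)"
  proof -
    consider "k = l" | "k < l" | "l < k" by linarith
    then show ?thesis
    proof cases
      case 1
      show ?thesis
      proof (cases "m = n")
        case True
        have "cinner (vecE s m) (vecE t m) = (if s = t then of_real ((norm (vecE s m))\<^sup>2) else 0)"
          using assms cinner_vecE[of s t m] by (auto simp: a b idx_def cinner_self)
        then show ?thesis
          using 1 True by (simp add: a b)
      qed (use 1 in \<open>simp add: a b cinner_vecE_neq\<close>)
    next
      case 2
      have "cinner (mult_zw (l - k) (vecE t n)) (vecE s m) = 0"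
        using 2 by (intro cinner_vecE_mult_zw vecE_in_M) auto
      then have "cinner (vecE s m) (mult_zw (l - k) (vecE t n)) = 0"
        by (subst cinner_commute) simp
      then show ?thesis
        using 2 cinner_mult_zw[of k "vecE s m" "mult_zw (l - k) (vecE t n)"]
        by (simp add: a b mult_zw_add[symmetric])
    next
      case 3
      have "cinner (mult_zw (k - l) (vecE s m)) (vecE t n) = 0"
        using 3 by (intro cinner_vecE_mult_zw vecE_in_M) auto
      then show ?thesis
        using 3 cinner_mult_zw[of l "mult_zw (k - l) (vecE s m)" "vecE t n"]
        by (simp add: a b mult_zw_add[symmetric])
    qed
  qed
  then show ?thesis
    using norm_vecE_pos[of k m s] assms
    by (auto simp: a b basis_vec_def cinner_simps power2_eq_square)
qed

lemma inj_basis_vec: "inj_on basis_vec idx"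
proof (rule inj_onI)
  fix a b assume "a \<in> idx" "b \<in> idx" "basis_vec a = basis_vec b"
  then show "a = b"
    using cinner_basis_vec[of a b] cinner_basis_vec[of a a] by (auto split: if_splits)
qed

lemma comb_ends_0:
  assumes "c 0 = 0" "c m = 0"
  shows "comb m c = 0 \<or> (\<exists>n d. n < m \<and> comb m c = mult_z (mult_w (comb n d)))"
proof (cases m)
  case (Suc n)
  then have *: "comb m c = mult_z (comb n (\<lambda>k. c (Suc k)))" using assms by (simp add: comb_eq_mult_z)
  show ?thesis
  proof (cases n)
    case (Suc n')
    then have "comb n (\<lambda>k. c (Suc k)) = mult_w (comb n' (\<lambda>k. c (Suc k)))"
      using assms \<open>m = Suc n\<close> by (simp add: comb_eq_mult_w)
    then show ?thesis using * Suc \<open>m = Suc n\<close> by (metis lessI less_SucI)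
  qed (use * assms Suc in \<open>simp add: comb_def\<close>)
qed (use assms in \<open>simp add: comb_def\<close>)

text \<open>Subtracting suitable multiples of U and V makes both end coefficients vanish; the rest
  is zero or zw times an element of lower degree.\<close>

lemma comb_in_span: "comb m c \<in> hardy2.span (basis_vec ` idx)" (is "_ \<in> ?W")
proof (induction m arbitrary: c rule: less_induct)
  case (less m)
  have zw: "mult_z (mult_w f) \<in> ?W" if "f \<in> ?W" for f
    using that
  proof (rule hardy2.span_induct)
    show "hardy2.subspace {f. mult_z (mult_w f) \<in> ?W}"
      by (rule hardy2.subspaceI)
        (auto simp: mult_z_add mult_w_add mult_z_scaleC mult_w_scaleC
          hardy2.span_zero hardy2.span_add hardy2.span_scale)
    fix x assume "x \<in> basis_vec ` idx"
    then obtain k n s where x: "x = basis_vec (k, n, s)" "(k, n, s) \<in> idx" by auto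
    then have "mult_z (mult_w x) = basis_vec (Suc k, n, s)" "(Suc k, n, s) \<in> idx"
      by (auto simp: basis_vec_def mult_zw_Suc mult_z_scaleC mult_w_scaleC idx_def)
    then show "mult_z (mult_w x) \<in> ?W" by (auto intro: hardy2.span_base)
  qed
  have E: "vecE s m \<in> ?W" if "s = 1 \<or> s = -1" for s
  proof (cases "(0, m, s) \<in> idx")
    case True
    then have "vecE s m = of_real (norm (vecE s m)) *\<^sub>C basis_vec (0, m, s)"
      using norm_vecE_pos[OF True] by (simp add: basis_vec_def)
    then show ?thesis using True by (metis hardy2.span_base hardy2.span_scale imageI)
  next
    case False
    then have "vecE s m = 0" using that by (auto simp: idx_def vecE_def vecU_def vecV_def comb_def)
    then show ?thesis by (simp add: hardy2.span_zero)
  qed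
  have sum: "vecE 1 m + vecE (-1) m = 2 *\<^sub>C vecU m" "vecE 1 m - vecE (-1) m = 2 *\<^sub>C vecV m"
    using hardy2.scale_left_distrib[of 1 1] by (simp_all add: vecE_def)
  have "(1/2) *\<^sub>C (vecE 1 m + vecE (-1) m) \<in> ?W" "(1/2) *\<^sub>C (vecE 1 m - vecE (-1) m) \<in> ?W"
    by (intro hardy2.span_scale hardy2.span_add hardy2.span_diff E; simp)+
  then have U: "vecU m \<in> ?W" and V: "vecV m \<in> ?W"
    unfolding sum by simp_all
  \<comment> \<open>With g = \<open>wgt m 0\<close> and l = \<open>lam m\<close>, the end
    coefficients of U and V are (g, l g) and (l g, g). For m > 0, l < 1 makes this system solvable
    by Cramer's rule; at m = 0 the vectors coincide and one of them suffices.\<close>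
  obtain a b where ab: "c 0 = a * wgt m 0 + b * wgt m (int m)" "c m = a * wgt m (int m) + b * wgt m 0"
  proof (cases "m = 0")
    case True
    then show ?thesis using that[of "c 0 / wgt 0 0" 0] wgt_0_pos[of 0] by simp
  next
    case False
    define g l where "g = wgt m 0" and "l = lam m"
    have g: "g \<noteq> 0" using wgt_0_pos[of m] by (simp add: g_def)
    have "l\<^sup>2 < 1" using lam_less_1[of m] lam_pos[of m] False by (simp add: l_def power_less_one_iff)
    then have l: "1 - l\<^sup>2 \<noteq> 0" by simp
    show ?thesis
    proof (rule that[of "(c 0 - l * c m) / ((1 - l\<^sup>2) * g)" "(c m - l * c 0) / ((1 - l\<^sup>2) * g)"])
      have "(x - l * y) / ((1 - l\<^sup>2) * g) * g + (y - l * x) / ((1 - l\<^sup>2) * g) * (l * g) = x" for x y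
      proof -
        have "(x - l * y) / ((1 - l\<^sup>2) * g) * g + (y - l * x) / ((1 - l\<^sup>2) * g) * (l * g) =
            ((x - l * y) + (y - l * x) * l) / (1 - l\<^sup>2)"
          using g by (simp add: add_divide_distrib)
        also have "(x - l * y) + (y - l * x) * l = x * (1 - l\<^sup>2)"
          by (simp add: algebra_simps power2_eq_square)
        finally show ?thesis using l by simp
      qed
      from this[of "c 0" "c m"] this[of "c m" "c 0"]
      show "c 0 = (c 0 - l * c m) / ((1 - l\<^sup>2) * g) * wgt m 0 +
          (c m - l * c 0) / ((1 - l\<^sup>2) * g) * wgt m (int m)"
        "c m = (c 0 - l * c m) / ((1 - l\<^sup>2) * g) * wgt m (int m) +
          (c m - l * c 0) / ((1 - l\<^sup>2) * g) * wgt m 0"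
        by (simp_all add: wgt_m g_def[symmetric] l_def[symmetric] add.commute)
    qed
  qed
  define d where "d = (\<lambda>k. c k - a * wgt m (int k) - b * wgt m (int m - int k))"
  have c: "comb m c = comb m d + of_real a *\<^sub>C vecU m + of_real b *\<^sub>C vecV m"
    by (simp add: d_def comb_diff[symmetric] vecU_def vecV_def)
  have "d 0 = 0" "d m = 0" using ab by (simp_all add: d_def)
  then have "comb m d \<in> ?W"
    using comb_ends_0[of d m] less zw hardy2.span_zero[of "basis_vec ` idx"] by metis
  then show ?case
    unfolding c by (intro hardy2.span_add hardy2.span_scale U V)
qed

lemma orthonormal_basis: "orthonormal_basis_of M (basis_vec ` idx)"
proof -
  have "P i j = comb (i + j) (\<lambda>k. if k = i then 1 else 0)" for i j
    by (simp add: comb_def if_distrib[of of_real] if_distrib[of "\<lambda>c. c *\<^sub>C _"] cong: if_cong)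
  then have "range (\<lambda>(i, j). P i j) \<subseteq> hardy2.span (basis_vec ` idx)"
    using comb_in_span by auto
  then have "hardy2.span (range (\<lambda>(i, j). P i j)) \<subseteq> hardy2.span (basis_vec ` idx)"
    by (intro hardy2.span_minimal hardy2.subspace_span)
  then have "M \<subseteq> closure (hardy2.span (basis_vec ` idx))"
    unfolding diag_submodule_eq by (rule closure_mono)
  moreover have "hardy2.span (basis_vec ` idx) \<subseteq> M"
    by (intro hardy2.span_minimal subspace_M) (auto simp: basis_vec_in_M)
  then have "closure (hardy2.span (basis_vec ` idx)) \<subseteq> M"
    by (rule closure_minimal[OF _ closed_M])
  ultimately show ?thesis
    using inj_basis_vec by (auto simp: orthonormal_basis_of_def cinner_basis_vec inj_on_eq_iff)
qed

section \<open>Core operator and cross commutator\<close>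

abbreviation "Rz' \<equiv> adjoint_on M mult_z"
abbreviation "Rw' \<equiv> adjoint_on M mult_w"

lemma Rz'_in_M: "Rz' g \<in> M"
  and cinner_Rz': "f \<in> M \<Longrightarrow> cinner f (Rz' g) = cinner (mult_z f) g"
  using adjoint_on_isometry[OF orthonormal_basis bounded_linear_mult_z mult_z_scaleC cinner_mult_z]
  by auto

lemma Rw'_in_M: "Rw' g \<in> M"
  and cinner_Rw': "f \<in> M \<Longrightarrow> cinner f (Rw' g) = cinner (mult_w f) g"
  using adjoint_on_isometry[OF orthonormal_basis bounded_linear_mult_w mult_w_scaleC cinner_mult_w]
  by auto

lemma cinner_Rz'_left: "f \<in> M \<Longrightarrow> cinner (Rz' g) f = cinner g (mult_z f)"
  by (subst cinner_commute) (simp add: cinner_Rz' cinner_commute[of g "mult_z f"])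

lemma cinner_Rw'_left: "f \<in> M \<Longrightarrow> cinner (Rw' g) f = cinner g (mult_w f)"
  by (subst cinner_commute) (simp add: cinner_Rw' cinner_commute[of g "mult_w f"])

lemmas in_M = Rz'_in_M Rw'_in_M mult_z_in_M mult_w_in_M vecU_in_M vecV_in_M vecE_in_M
  M_add M_diff M_scale M_0

lemma Rz'_eqI: "h \<in> M \<Longrightarrow> (\<And>f. f \<in> M \<Longrightarrow> cinner (mult_z f) g = cinner f h) \<Longrightarrow> Rz' g = h"
  by (rule adjoint_on_eqI[OF subspace_M])

lemma Rw'_eqI: "h \<in> M \<Longrightarrow> (\<And>f. f \<in> M \<Longrightarrow> cinner (mult_w f) g = cinner f h) \<Longrightarrow> Rw' g = h"
  by (rule adjoint_on_eqI[OF subspace_M])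

lemma Rz'_mult_z: "f \<in> M \<Longrightarrow> Rz' (mult_z f) = f"
  by (rule Rz'_eqI) simp_all

lemma Rw'_mult_w: "f \<in> M \<Longrightarrow> Rw' (mult_w f) = f"
  by (rule Rw'_eqI) simp_all

lemma Rz'_add: "Rz' (f + g) = Rz' f + Rz' g"
  by (rule Rz'_eqI) (simp_all add: in_M cinner_Rz' cinner_simps)

lemma Rw'_add: "Rw' (f + g) = Rw' f + Rw' g"
  by (rule Rw'_eqI) (simp_all add: in_M cinner_Rw' cinner_simps)

lemma Rz'_scaleC: "Rz' (c *\<^sub>C f) = c *\<^sub>C Rz' f"
  by (rule Rz'_eqI) (simp_all add: in_M cinner_Rz' cinner_simps)

lemma Rw'_scaleC: "Rw' (c *\<^sub>C f) = c *\<^sub>C Rw' f"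
  by (rule Rw'_eqI) (simp_all add: in_M cinner_Rw' cinner_simps)

lemma Rz'_diff: "Rz' (f - g) = Rz' f - Rz' g"
  by (rule Rz'_eqI) (simp_all add: in_M cinner_Rz' cinner_simps)

lemma Rz'_vecU: "Rz' (vecU m) = 0"
  by (rule Rz'_eqI) (simp_all add: in_M cinner_mult_z_vecU)

lemma Rw'_vecV: "Rw' (vecV m) = 0"
  by (rule Rw'_eqI) (simp_all add: in_M cinner_mult_w_vecV)

lemma Rz'_0 [simp]: "Rz' 0 = 0"
  by (rule Rz'_eqI) (simp_all add: in_M)

lemma Rw'_0 [simp]: "Rw' 0 = 0"
  by (rule Rw'_eqI) (simp_all add: in_M)

lemma Rz'_Rw': "Rz' (Rw' f) = Rw' (Rz' f)"
  by (rule Rz'_eqI) (simp_all add: in_M cinner_Rz' cinner_Rw' mult_z_mult_w)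

lemma core_op_eq: "core_op M f =
    f - mult_z (Rz' f) - mult_w (Rw' f) + mult_z (mult_w (Rz' (Rw' f)))"
  by (simp add: core_op_def Let_def)

lemma core_op_in_M: "f \<in> M \<Longrightarrow> core_op M f \<in> M"
  unfolding core_op_eq by (intro in_M)

text \<open>Besides the identity, each term is multiplication by z, w or zw composed with its
  adjoint. Hence \<open>hs_norm_eqI\<close> can take the core operator as its own adjoint.\<close>

lemma core_op_selfadjoint:
  assumes "f \<in> M" "g \<in> M"
  shows "cinner (core_op M f) g = cinner f (core_op M g)"
proof -
  have 1: "cinner (mult_z (Rz' f)) g = cinner f (mult_z (Rz' g))"
    using assms by (simp add: cinner_Rz'[symmetric] cinner_Rz'_left in_M)
  have 2: "cinner (mult_w (Rw' f)) g = cinner f (mult_w (Rw' g))"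
    using assms by (simp add: cinner_Rw'[symmetric] cinner_Rw'_left in_M)
  have "cinner (mult_z (mult_w (Rz' (Rw' f)))) g = cinner (Rz' (Rw' f)) (Rw' (Rz' g))"
    by (simp add: cinner_Rz' cinner_Rw' in_M)
  also have "\<dots> = cinner f (mult_z (mult_w (Rz' (Rw' g))))"
    by (simp add: cinner_Rz'_left cinner_Rw'_left in_M Rz'_Rw'[symmetric] mult_z_mult_w)
  finally show ?thesis
    by (simp add: core_op_eq cinner_simps 1 2)
qed

lemma core_op_add: "core_op M (f + g) = core_op M f + core_op M g"
  by (simp add: core_op_eq Rz'_add Rw'_add mult_z_add mult_w_add)

lemma core_op_scaleC: "core_op M (c *\<^sub>C f) = c *\<^sub>C core_op M f"
  by (simp add: core_op_eq Rz'_scaleC Rw'_scaleC mult_z_scaleC mult_w_scaleC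
      hardy2.scale_right_distrib hardy2.scale_right_diff_distrib)

text \<open>All three products of a multiplication with its adjoint fix a vector of zw M, and 1 - 1
  - 1 + 1 = 0.\<close>

lemma core_op_mult_z_mult_w: "f \<in> M \<Longrightarrow> core_op M (mult_z (mult_w f)) = 0"
  by (simp add: core_op_eq Rz'_mult_z in_M) (simp add: mult_z_mult_w Rw'_mult_w Rz'_mult_z in_M)

text \<open>The adjoint of z kills U, so only U minus its component in w M is left, and
  \<open>vecU_eq\<close> identifies that as a multiple of V.\<close>

lemma core_op_vecU: "core_op M (vecU m) = of_real (lam m) *\<^sub>C vecV m"
proof -
  obtain f where f: "f \<in> M" "vecU m = of_real (lam m) *\<^sub>C vecV m + mult_w f"
    using vecU_eq by blast
  have "Rw' (vecU m) = f"
    using f by (simp add: Rw'_add Rw'_scaleC Rw'_vecV Rw'_mult_w)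
  moreover have "Rz' (Rw' (vecU m)) = 0"
    by (simp add: Rz'_Rw' Rz'_vecU)
  ultimately have "core_op M (vecU m) = vecU m - mult_w f"
    by (simp add: core_op_eq Rz'_vecU)
  then show ?thesis using f(2) by simp
qed

lemma core_op_vecV: "core_op M (vecV m) = of_real (lam m) *\<^sub>C vecU m"
proof -
  obtain f where f: "f \<in> M" "vecV m = of_real (lam m) *\<^sub>C vecU m + mult_z f"
    using vecV_eq by blast
  have "Rz' (vecV m) = f"
    using f by (simp add: Rz'_add Rz'_scaleC Rz'_vecU Rz'_mult_z)
  moreover have "Rz' (Rw' (vecV m)) = 0"
    by (simp add: Rw'_vecV)
  ultimately have "core_op M (vecV m) = vecV m - mult_z f"
    by (simp add: core_op_eq Rw'_vecV)
  then show ?thesis using f(2) by simp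
qed

definition core_ev :: "nat \<times> nat \<times> real \<Rightarrow> real" where
  "core_ev = (\<lambda>(k, m, s). if k = 0 then s * lam m else 0)"

lemma core_op_basis_vec:
  assumes "a \<in> idx"
  shows "core_op M (basis_vec a) = of_real (core_ev a) *\<^sub>C basis_vec a"
proof -
  obtain k m s where a: "a = (k, m, s)" by (cases a)
  have s: "s = 1 \<or> s = -1" using assms by (auto simp: a idx_def)
  show ?thesis
  proof (cases k)
    case 0
    \<comment> \<open>The operator exchanges U and V up to \<open>lam m\<close>, and s^2 =
      1.\<close>
    have "core_op M (vecE s m) = of_real (s * lam m) *\<^sub>C vecE s m"
      using s by (auto simp: vecE_def core_op_add core_op_scaleC core_op_vecU core_op_vecV
          hardy2.scale_right_distrib add.commute)
    then show ?thesis
      by (simp add: a 0 basis_vec_def core_ev_def core_op_scaleC mult.commute)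
  next
    case (Suc k')
    then show ?thesis
      by (simp add: a basis_vec_def core_ev_def core_op_scaleC mult_zw_Suc core_op_mult_z_mult_w
          mult_zw_in_M vecE_in_M)
  qed
qed

section \<open>The cross commutator\<close>

lemma cross_comm_eq: "cross_comm M f = Rz' (mult_w f) - mult_w (Rz' f)"
  by (simp add: cross_comm_def Let_def)

lemma cross_comm_in_M: "f \<in> M \<Longrightarrow> cross_comm M f \<in> M"
  unfolding cross_comm_eq by (intro in_M)

text \<open>An explicit adjoint within \<open>M\<close> is what \<open>hs_norm_eqI\<close> requires
  to be independent of the basis.\<close>

lemma cross_comm_adjoint:
  assumes "f \<in> M" "g \<in> M"
  shows "cinner (cross_comm M f) g = cinner f (Rw' (mult_z g) - mult_z (Rw' g))"
proof -
  have "cinner (Rz' (mult_w f)) g = cinner f (Rw' (mult_z g))"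
    using assms by (simp add: cinner_Rz'_left cinner_Rw')
  moreover have "cinner (mult_w (Rz' f)) g = cinner f (mult_z (Rw' g))"
    by (simp add: cinner_Rw'[symmetric] cinner_Rz'_left in_M)
  ultimately show ?thesis by (simp add: cross_comm_eq cinner_simps)
qed

lemma cross_comm_add: "cross_comm M (f + g) = cross_comm M f + cross_comm M g"
  by (simp add: cross_comm_eq Rz'_add mult_w_add)

lemma cross_comm_scaleC: "cross_comm M (c *\<^sub>C f) = c *\<^sub>C cross_comm M f"
  by (simp add: cross_comm_eq Rz'_scaleC mult_w_scaleC hardy2.scale_right_diff_distrib)

lemma cross_comm_mult_z: "f \<in> M \<Longrightarrow> cross_comm M (mult_z f) = 0"
  by (simp add: cross_comm_eq mult_z_mult_w[symmetric] Rz'_mult_z in_M)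

lemma cross_comm_vecV: "cross_comm M (vecV m) = of_real (lam m) *\<^sub>C cross_comm M (vecU m)"
proof -
  obtain f where "f \<in> M" "vecV m = of_real (lam m) *\<^sub>C vecU m + mult_z f"
    using vecV_eq by blast
  then show ?thesis
    by (simp add: cross_comm_add cross_comm_scaleC cross_comm_mult_z)
qed

lemma norm_vecV_diff:
  "norm (vecV m - of_real a *\<^sub>C vecU m) = norm (vecU m - of_real a *\<^sub>C vecV m)"
proof -
  note UV = cinner_vecU_vecV[of m, unfolded norm_vecV] and VU = cinner_vecV_vecU[of m]
  have "cinner (vecV m - of_real a *\<^sub>C vecU m) (vecV m - of_real a *\<^sub>C vecU m) =
      cinner (vecU m - of_real a *\<^sub>C vecV m) (vecU m - of_real a *\<^sub>C vecV m)"
    by (simp add: cinner_simps UV VU cinner_self[of "vecU m"] cinner_self[of "vecV m"] norm_vecV)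
  then show ?thesis unfolding cinner_self of_real_eq_iff by (simp add: power2_eq_iff_nonneg)
qed

text \<open>The adjoint of z sends V_(m+1) to the \<open>f\<close> with z f = V_(m+1) - l U_(m+1),
  whose norm is that of U_(m+1) - l V_(m+1). The latter times \<open>b\<close> is the norm of w U_m,
  so \<open>b\<close> drops out.\<close>

lemma norm_cross_comm_vecU: "norm (cross_comm M (vecU m)) = lam (Suc m) * norm (vecU m)"
proof -
  define b where "b = real (m + 1 + N) / real (m + 1 + 2 * N)"
  have b: "b \<ge> 0" by (simp add: b_def)
  let ?U = "vecU (Suc m)" and ?V = "vecV (Suc m)" and ?l = "lam (Suc m)"
  obtain f where f: "f \<in> M" "?V = of_real ?l *\<^sub>C ?U + mult_z f"
    using vecV_eq by blast
  have w: "mult_w (vecU m) = of_real b *\<^sub>C (?U - of_real ?l *\<^sub>C ?V)"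
    unfolding b_def by (rule mult_w_vecU)
  have "Rz' ?V = f"
    using f by (simp add: Rz'_add Rz'_scaleC Rz'_vecU Rz'_mult_z)
  then have "cross_comm M (vecU m) = of_real (- b * ?l) *\<^sub>C f"
    unfolding cross_comm_eq Rz'_vecU w
    by (simp add: Rz'_scaleC Rz'_diff Rz'_vecU)
  then have "norm (cross_comm M (vecU m)) = b * ?l * norm f"
    using b lam_pos[of "Suc m"] by (simp add: norm_mult)
  also have "norm f = norm (?V - of_real ?l *\<^sub>C ?U)"
    using f(2) by (metis add_diff_cancel_left' norm_mult_z)
  also have "\<dots> = norm (?U - of_real ?l *\<^sub>C ?V)"
    by (rule norm_vecV_diff)
  also have "b * ?l * \<dots> = ?l * norm (mult_w (vecU m))"
    unfolding w using b by simp
  finally show ?thesis by simp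
qed

text \<open>One factor \<open>1 + s * lam m\<close> cancels against the normalisation. The two signs
  then add up to \<open>(lam (Suc m))^2\<close>; at m = 0 the single sign already gives this, since
  \<open>lam 0 = 1\<close>.\<close>

lemma norm_cross_comm_basis_vec:
  assumes "(k, m, s) \<in> idx"
  shows "(norm (cross_comm M (basis_vec (k, m, s))))\<^sup>2 =
    (if k = 0 then (lam (Suc m))\<^sup>2 * (1 + s * lam m) / 2 else 0)"
proof (cases k)
  case 0
  have s: "s = 1 \<or> s = -1" using assms by (auto simp: idx_def)
  have "cross_comm M (vecE s m) = of_real (1 + s * lam m) *\<^sub>C cross_comm M (vecU m)"
    by (simp add: vecE_def cross_comm_add cross_comm_scaleC cross_comm_vecV hardy2.scale_left_distrib)
  then have "norm (cross_comm M (vecE s m)) = (1 + s * lam m) * (lam (Suc m) * norm (vecU m))"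
    using idx_pos[OF assms] by (simp only: norm_scaleC norm_cross_comm_vecU norm_of_real abs_of_pos)
  then have "(norm (cross_comm M (basis_vec (k, m, s))))\<^sup>2 =
      ((1 + s * lam m) * (lam (Suc m) * norm (vecU m)))\<^sup>2 / (2 * (1 + s * lam m) * (norm (vecU m))\<^sup>2)"
    by (simp add: 0 basis_vec_def cross_comm_scaleC norm_divide power_divide norm_vecE[OF s])
  also have "(x * (l * n))\<^sup>2 / (2 * x * n\<^sup>2) = l\<^sup>2 * x / 2" if "x \<noteq> 0" "n \<noteq> 0" for x l n :: real
    using that by (simp add: field_simps power2_eq_square)
  finally show ?thesis
    using idx_pos[OF assms] vecU_nonzero[of m] by (simp add: 0)
next
  case (Suc k')
  then show ?thesis
    by (simp add: basis_vec_def cross_comm_scaleC mult_zw_Suc cross_comm_mult_z in_M mult_zw_in_M)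
qed

section \<open>Evaluation of the norms and the spectrum\<close>

lemma has_sum_idx:
  fixes f :: "nat \<times> nat \<times> real \<Rightarrow> real"
  assumes nonneg: "\<And>a. a \<in> idx \<Longrightarrow> 0 \<le> f a"
    and zero: "\<And>k m s. (k, m, s) \<in> idx \<Longrightarrow> 0 < k \<Longrightarrow> f (k, m, s) = 0"
    and sum: "((\<lambda>m. if m = 0 then f (0, 0, 1) else f (0, m, 1) + f (0, m, -1)) has_sum t) UNIV"
  shows "(f has_sum t) idx"
proof -
  define A where "A m = (if m = 0 then {1} else {1, -1 :: real})" for m :: nat
  have A: "s \<in> A m \<longleftrightarrow> (0, m, s) \<in> idx" for m s by (auto simp: A_def idx_def)
  have row: "((\<lambda>s. case (m, s) of (m, s) \<Rightarrow> f (0, m, s)) has_sum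
      (if m = 0 then f (0, 0, 1) else f (0, m, 1) + f (0, m, -1))) (A m)" for m
    by (rule has_sum_finiteI) (auto simp: A_def)
  have "(\<lambda>(m, s). f (0, m, s)) summable_on Sigma UNIV A"
    by (rule summable_on_SigmaI[OF row])
      (use sum nonneg A in \<open>auto simp: summable_on_def\<close>)
  then have "((\<lambda>(m, s). f (0, m, s)) has_sum t) (Sigma UNIV A)"
    by (rule has_sum_SigmaI[OF row sum])
  also have "?this \<longleftrightarrow> (f has_sum t) {a \<in> idx. fst a = 0}"
    by (rule has_sum_reindex_bij_witness[of _ "\<lambda>(k, m, s). (m, s)" "\<lambda>(m, s). (0, m, s)"])
      (auto simp: A)
  also have "\<dots> \<longleftrightarrow> (f has_sum t) idx"
    by (rule has_sum_cong_neutral) (use zero in auto)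
  finally show ?thesis .
qed

lemma has_sum_lam: "((\<lambda>m. (lam (Suc m))\<^sup>2) has_sum (real N)\<^sup>2 * inv_sq_tail N) UNIV"
  using has_sum_cmult_right[OF has_sum_inv_sq_tail, of "(real N)\<^sup>2"]
  by (simp add: lam_def power_divide)

lemma hs_norm_cross_comm:
  "hs_norm M (cross_comm M) = ereal (sqrt ((real N)\<^sup>2 * inv_sq_tail N))"
proof (rule hs_norm_eqI[OF orthonormal_basis cross_comm_in_M _ cross_comm_adjoint])
  have "((\<lambda>a. (norm (cross_comm M (basis_vec a)))\<^sup>2) has_sum (real N)\<^sup>2 * inv_sq_tail N) idx"
  proof (rule has_sum_idx)
    have "(if m = 0 then (norm (cross_comm M (basis_vec (0, 0, 1))))\<^sup>2
        else (norm (cross_comm M (basis_vec (0, m, 1))))\<^sup>2 +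
          (norm (cross_comm M (basis_vec (0, m, -1))))\<^sup>2) = (lam (Suc m))\<^sup>2" for m
      by (cases m) (simp_all add: norm_cross_comm_basis_vec idx_def field_simps)
    then show "((\<lambda>m. if m = 0 then (norm (cross_comm M (basis_vec (0, 0, 1))))\<^sup>2
        else (norm (cross_comm M (basis_vec (0, m, 1))))\<^sup>2 +
          (norm (cross_comm M (basis_vec (0, m, -1))))\<^sup>2) has_sum (real N)\<^sup>2 * inv_sq_tail N) UNIV"
      using has_sum_lam by simp
  qed (simp_all add: norm_cross_comm_basis_vec)
  then show "((\<lambda>e. (norm (cross_comm M e))\<^sup>2) has_sum (real N)\<^sup>2 * inv_sq_tail N) (basis_vec ` idx)"
    by (subst has_sum_reindex[OF inj_basis_vec]) (simp add: o_def)
qed (auto intro!: in_M)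

lemma norm_core_op_basis_vec: "a \<in> idx \<Longrightarrow> (norm (core_op M (basis_vec a)))\<^sup>2 = (core_ev a)\<^sup>2"
proof -
  assume a: "a \<in> idx"
  have "(norm (basis_vec a))\<^sup>2 = 1"
    using cinner_basis_vec[OF a a] unfolding cinner_self by (simp add: of_real_eq_1_iff del: of_real_power)
  then show ?thesis
    using a by (simp add: core_op_basis_vec power_mult_distrib)
qed

lemma hs_norm_core_op:
  "hs_norm M (core_op M) = ereal (sqrt (1 + 2 * (real N)\<^sup>2 * inv_sq_tail N))"
proof (rule hs_norm_eqI[OF orthonormal_basis core_op_in_M core_op_in_M core_op_selfadjoint])
  let ?t = "1 + 2 * (real N)\<^sup>2 * inv_sq_tail N"
  have "((\<lambda>a. (norm (core_op M (basis_vec a)))\<^sup>2) has_sum ?t) idx"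
  proof (rule has_sum_idx)
    \<comment> \<open>Degree 0 carries only the eigenvalue 1; every later degree carries the pair
      \<open>lam m\<close> and \<open>- lam m\<close>.\<close>
    let ?g = "\<lambda>m. if m = 0 then 1 else 2 * (lam m)\<^sup>2"
    have "(?g has_sum 2 * ((real N)\<^sup>2 * inv_sq_tail N)) (range Suc)"
      by (subst has_sum_reindex) (use has_sum_cmult_right[OF has_sum_lam, of 2] in \<open>simp_all add: o_def\<close>)
    then have "(?g has_sum (1 + 2 * ((real N)\<^sup>2 * inv_sq_tail N))) (insert 0 (range Suc))"
      using has_sum_insert[of 0 "range Suc" ?g] by auto
    moreover have "insert 0 (range Suc) = UNIV"
      using not0_implies_Suc by blast
    moreover have "(if m = 0 then (norm (core_op M (basis_vec (0, 0, 1))))\<^sup>2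
        else (norm (core_op M (basis_vec (0, m, 1))))\<^sup>2 +
          (norm (core_op M (basis_vec (0, m, -1))))\<^sup>2) = ?g m" for m
      by (cases m) (simp_all add: norm_core_op_basis_vec idx_def core_ev_def)
    ultimately show "((\<lambda>m. if m = 0 then (norm (core_op M (basis_vec (0, 0, 1))))\<^sup>2
        else (norm (core_op M (basis_vec (0, m, 1))))\<^sup>2 +
          (norm (core_op M (basis_vec (0, m, -1))))\<^sup>2) has_sum ?t) UNIV"
      by (simp add: mult.assoc)
  qed (simp_all add: norm_core_op_basis_vec core_ev_def)
  then show "((\<lambda>e. (norm (core_op M e))\<^sup>2) has_sum ?t) (basis_vec ` idx)"
    by (subst has_sum_reindex[OF inj_basis_vec]) (simp add: o_def)
qed

lemma spectrum_core_op:
  "spectrum_on M (core_op M) - {0} =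
     insert 1 (\<Union>j\<in>{1..}. {of_nat N / of_nat (N + j), - (of_nat N / of_nat (N + j))})"
    (is "_ = ?R")
proof -
  \<comment> \<open>The diagonal matrix entry serves as eigenvalue because
    \<open>spectrum_on_diagonal\<close> needs a function of the vector, not of its index.\<close>
  define \<mu> where "\<mu> e = cinner (core_op M e) e" for e
  have \<mu>: "\<mu> (basis_vec a) = of_real (core_ev a)" if "a \<in> idx" for a
    using that cinner_basis_vec[OF that that] by (simp add: \<mu>_def core_op_basis_vec cinner_simps)
  have diag: "cinner (core_op M f) e = \<mu> e * cinner f e" if f: "f \<in> M" and e: "e \<in> basis_vec ` idx" for f e
  proof -
    obtain a where a: "e = basis_vec a" "a \<in> idx" using e by blast
    then have "cinner (core_op M f) e = cinner f (of_real (core_ev a) *\<^sub>C e)"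
      using core_op_selfadjoint[OF f basis_vec_in_M] by (simp add: core_op_basis_vec)
    then show ?thesis using \<mu> a by (simp add: cinner_simps)
  qed
  note spec = spectrum_on_diagonal[OF orthonormal_basis core_op_in_M diag]
  have lam_complex: "of_nat N / of_nat (N + j) = complex_of_real (lam j)" for j
    by (simp add: lam_def)
  have R: "?R = insert 1 (range (\<lambda>j. of_real (lam (Suc j))) \<union> range (\<lambda>j. - of_real (lam (Suc j))))"
  proof -
    have "{1..} = range Suc" by (auto simp: image_iff Suc_le_eq gr0_conv_Suc)
    then show ?thesis unfolding lam_complex by auto
  qed
  have im: "\<mu> ` basis_vec ` idx \<subseteq> insert 0 ?R"
  proof (rule subsetI)
    fix x assume "x \<in> \<mu> ` basis_vec ` idx"
    then obtain k m s where a: "(k, m, s) \<in> idx" "x = of_real (core_ev (k, m, s))"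
      using \<mu> by (auto simp del: split_paired_Ex)
    then show "x \<in> insert 0 ?R"
      unfolding R by (cases m) (auto simp: core_ev_def idx_def)
  qed
  have "(\<lambda>j. complex_of_real (lam (Suc j))) \<longlonglongrightarrow> of_real 0"
    unfolding lam_def by (rule tendsto_of_real) real_asymp
  then have lim: "(\<lambda>j. complex_of_real (lam (Suc j))) \<longlonglongrightarrow> 0" by simp
  then have "(\<lambda>j. - complex_of_real (lam (Suc j))) \<longlonglongrightarrow> 0"
    using tendsto_minus[OF lim] by simp
  \<comment> \<open>A convergent sequence together with its limit is compact, so the closure of the
    eigenvalues can add nothing but 0.\<close>
  with lim have "compact (insert 0 (range (\<lambda>j. complex_of_real (lam (Suc j)))) \<union>
      insert 0 (range (\<lambda>j. - complex_of_real (lam (Suc j)))))"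
    by (intro compact_Un compact_sequence_with_limit)
  then have "closed (insert 1 (insert 0 (range (\<lambda>j. complex_of_real (lam (Suc j)))) \<union>
      insert 0 (range (\<lambda>j. - complex_of_real (lam (Suc j))))))"
    by (intro closed_insert compact_imp_closed)
  also have "insert 1 (insert 0 (range (\<lambda>j. complex_of_real (lam (Suc j)))) \<union>
      insert 0 (range (\<lambda>j. - complex_of_real (lam (Suc j))))) = insert 0 ?R"
    unfolding R by auto
  finally have "closure (\<mu> ` basis_vec ` idx) \<subseteq> insert 0 ?R"
    by (rule closure_minimal[OF im])
  then have 1: "spectrum_on M (core_op M) \<subseteq> insert 0 ?R"
    using spec(2) by blast
  have "of_real (core_ev (0, m, s)) \<in> spectrum_on M (core_op M)" if "(0, m, s) \<in> idx" for m s
    using spec(1) \<mu>[OF that] that by (metis image_eqI subsetD)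
  from this[of 0 1] this[of "Suc _" 1] this[of "Suc _" "-1"]
  have 2: "?R \<subseteq> spectrum_on M (core_op M)"
    unfolding R by (auto simp: idx_def core_ev_def)
  have "0 \<notin> ?R"
    using lam_pos unfolding R by (auto simp: less_le)
  then show ?thesis using 1 2 by blast
qed

end

section \<open>Unboundedness over homogeneous polynomials\<close>

lemma homogeneous_diag: "homogeneous2 ((var_z - var_w) ^ N)"
proof -
  have "\<forall>i j. coeff (coeff ((var_z - var_w) ^ N) j) i \<noteq> 0 \<longrightarrow> i + j = N"
  proof (induction N)
    case (Suc N)
    have "coeff (coeff ((var_z - var_w) ^ Suc N) j) i =
        (if i = 0 then 0 else coeff (coeff ((var_z - var_w) ^ N) j) (i - 1))
        - (if j = 0 then 0 else coeff (coeff ((var_z - var_w) ^ N) (j - 1)) i)" for i j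
      by (simp add: left_diff_distrib var_z_def var_w_def coeff_pCons split: nat.split)
    then have "0 < i \<and> coeff (coeff ((var_z - var_w) ^ N) j) (i - 1) \<noteq> 0 \<or>
        0 < j \<and> coeff (coeff ((var_z - var_w) ^ N) (j - 1)) i \<noteq> 0"
      if "coeff (coeff ((var_z - var_w) ^ Suc N) j) i \<noteq> 0" for i j
      using that by (auto split: if_splits simp del: power_Suc)
    then show ?case using Suc by fastforce
  qed (auto simp: split: if_splits)
  then show ?thesis unfolding homogeneous2_def by blast
qed

lemma diag_nonzero: "(var_z - var_w) ^ N \<noteq> 0"
  by (simp add: var_z_def var_w_def)

theorem theorem5p1:
  shows "(\<forall>N\<ge>1.
           spectrum_on (diag_submodule N) (core_op (diag_submodule N)) - {0} =
             insert 1 (\<Union>j\<in>{1..}. {of_nat N / of_nat (N + j), - (of_nat N / of_nat (N + j))}) \<and>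
           (hs_norm (diag_submodule N) (cross_comm (diag_submodule N)))\<^sup>2 =
             ereal ((real N)\<^sup>2 * (\<Sum>\<^sub>\<infinity>j\<in>{N + 1..}. 1 / (real j)\<^sup>2)) \<and>
           (hs_norm (diag_submodule N) (core_op (diag_submodule N)))\<^sup>2 =
             ereal (1 + 2 * (real N)\<^sup>2 * (\<Sum>\<^sub>\<infinity>j\<in>{N + 1..}. 1 / (real j)\<^sup>2))) \<and>
         (\<lambda>N. real_of_ereal ((hs_norm (diag_submodule N) (core_op (diag_submodule N)))\<^sup>2) -
              (2 * real N + 1 / (3 * real N) - 1 / (15 * (real N) ^ 3)))
           \<in> O(\<lambda>N. 1 / (real N) ^ 5) \<and>
         (SUP p\<in>{p. p \<noteq> 0 \<and> homogeneous2 p}.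
            hs_norm (poly_submodule p) (core_op (poly_submodule p))) = \<infinity>"
proof (intro conjI allI impI)
  have tail: "0 \<le> inv_sq_tail N" for N
    unfolding inv_sq_tail_def by (rule infsum_nonneg) simp
  have core: "hs_norm (diag_submodule N) (core_op (diag_submodule N)) =
      ereal (sqrt (1 + 2 * (real N)\<^sup>2 * inv_sq_tail N))" if "1 \<le> N" for N
    using that by (intro diag_module.hs_norm_core_op) unfold_locales
  have core_sq: "(hs_norm (diag_submodule N) (core_op (diag_submodule N)))\<^sup>2 =
      ereal (1 + 2 * (real N)\<^sup>2 * inv_sq_tail N)" if "1 \<le> N" for N
    using tail[of N] by (simp add: core[OF that])
  {
    fix N :: nat assume N: "1 \<le> N"
    interpret diag_module N using N by unfold_locales
    show "spectrum_on (diag_submodule N) (core_op (diag_submodule N)) - {0} =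
        insert 1 (\<Union>j\<in>{1..}. {of_nat N / of_nat (N + j), - (of_nat N / of_nat (N + j))})"
      by (rule spectrum_core_op)
    show "(hs_norm (diag_submodule N) (cross_comm (diag_submodule N)))\<^sup>2 =
        ereal ((real N)\<^sup>2 * (\<Sum>\<^sub>\<infinity>j\<in>{N + 1..}. 1 / (real j)\<^sup>2))"
      using tail[of N] by (simp add: hs_norm_cross_comm power_mult_distrib inv_sq_tail_def)
    show "(hs_norm (diag_submodule N) (core_op (diag_submodule N)))\<^sup>2 =
        ereal (1 + 2 * (real N)\<^sup>2 * (\<Sum>\<^sub>\<infinity>j\<in>{N + 1..}. 1 / (real j)\<^sup>2))"
      using core_sq[OF N] by (simp add: inv_sq_tail_def)
  }
  show "(\<lambda>N. real_of_ereal ((hs_norm (diag_submodule N) (core_op (diag_submodule N)))\<^sup>2) -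
        (2 * real N + 1 / (3 * real N) - 1 / (15 * (real N) ^ 3))) \<in> O(\<lambda>N. 1 / (real N) ^ 5)"
  \<comment> \<open>The closed form is available for N at least 1 only, so it is substituted
    eventually.\<close>
  proof (subst landau_o.big.in_cong)
    show "\<forall>\<^sub>F N in sequentially.
        real_of_ereal ((hs_norm (diag_submodule N) (core_op (diag_submodule N)))\<^sup>2) -
          (2 * real N + 1 / (3 * real N) - 1 / (15 * (real N) ^ 3)) =
        1 + 2 * (real N)\<^sup>2 * inv_sq_tail N - (2 * real N + 1 / (3 * real N) - 1 / (15 * real N ^ 3))"
      by (rule eventually_sequentiallyI[of 1]) (simp add: core_sq)
  qed (rule inv_sq_tail_asymp)
  show "(SUP p\<in>{p. p \<noteq> 0 \<and> homogeneous2 p}.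
      hs_norm (poly_submodule p) (core_op (poly_submodule p))) = \<infinity>"
  proof (rule SUP_PInfty)
    fix n :: nat
    \<comment> \<open>A square, so that the lower bound by the root of N becomes n + 1.\<close>
    define N where "N = Suc n ^ 2"
    have N: "1 \<le> N" by (simp add: N_def)
    have "real n \<le> sqrt (real N)" by (simp add: N_def)
    also have "\<dots> \<le> sqrt (1 + 2 * (real N)\<^sup>2 * inv_sq_tail N)"
      using inv_sq_tail_ge[OF N] by simp
    finally have "ereal (real n) \<le> hs_norm (diag_submodule N) (core_op (diag_submodule N))"
      by (simp add: core[OF N])
    then show "\<exists>p\<in>{p. p \<noteq> 0 \<and> homogeneous2 p}.
        ereal (real n) \<le> hs_norm (poly_submodule p) (core_op (poly_submodule p))"
      using homogeneous_diag diag_nonzero unfolding diag_submodule_def by blast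
  qed
qed

end
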